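(* Let $0<s<1$, $m\in\mathbb{Z}$ and $\beta\in\mathbb{R}$, and suppose that none of the numbers $\frac{|m|+\beta}{2}+s$, $\frac{|m|-\beta}{2}+1$, $\frac{|m|+\beta}{2}$, $\frac{|m|-\beta}{2}+1-s$ is a non-positive integer. Then, in polar coordinates $(r,\theta)$ on $\mathbb{R}^2$, $$(-\Delta)^{s}\bigl(r^{-\beta}e^{im\theta}\bigr)=\mu_{|m|}(s,\beta)\,r^{-\beta-2s}e^{im\theta}\quad\text{if }\beta<2,$$ $$(-\Delta)^{-s}\bigl(r^{-\beta-2s}e^{im\theta}\bigr)=\mu_{|m|}(s,\beta)^{-1}\,r^{-\beta}e^{im\theta}\quad\text{if }\beta<2-2s,$$ with the constant $$\mu_{|m|}(s,\beta)=2^{2s}\,\frac{\Gamma(\frac{|m|+\beta}{2}+s)\,\Gamma(\frac{|m|-\beta}{2}+1)}{\Gamma(\frac{|m|+\beta}{2})\,\Gamma(\frac{|m|-\beta}{2}+1-s)}.$$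
   Context: The operators $(-\Delta)^{\pm s}$ on $\mathbb{R}^2$ are the Fourier multiplier operators with symbols $|\xi|^{\pm 2s}$; $(-\Delta)^{-s}$ is convolution with $C(s)|x|^{-(2-2s)}$, $C(s)=\frac{\Gamma(1-s)}{4^s\pi\Gamma(s)}$, whenever that integral converges. On functions $g(r)e^{im\theta}$ they act by $(-\Delta)^{\pm s}(g(r)e^{im\theta})=H_{|m|}\bigl[\rho^{\pm 2s}H_{|m|}[g]\bigr](r)\,e^{im\theta}$, where $H_{|m|}[g](\rho)=\int_0^\infty g(r)\,r\,J_{|m|}(\rho r)\,dr$ is the Hankel transform ($J_{|m|}$ the Bessel function of the first kind). For power functions, and for values of $\beta$ where the defining integrals do not converge, the operators are understood by analytic continuation in the exponent. *)

theory Defs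
  imports "HOL-Complex_Analysis.Complex_Analysis"
begin

text \<open>
  The plane is modelled by the type \<^typ>\<open>complex\<close> with Lebesgue measure \<^const>\<open>lborel\<close>; the polar
  coordinates of \<open>x \<noteq> 0\<close> are \<^term>\<open>cmod x\<close> and \<^term>\<open>Arg x\<close>.
\<close>

definition bessel_J :: "nat \<Rightarrow> real \<Rightarrow> real" where
  "bessel_J n x = (\<Sum>k. (-1) ^ k / (fact k * fact (k + n)) * (x / 2) ^ (2 * k + n))"

text \<open>
  \<open>has_hankel_integral n g \<rho> v\<close>: the integral of \<open>g r * r * J\<^sub>n (\<rho> r)\<close> over the half-line converges
  to \<open>v\<close>.  The gauge integral includes conditionally convergent improper integrals.
\<close>

definition has_hankel_integral :: "nat \<Rightarrow> (real \<Rightarrow> complex) \<Rightarrow> real \<Rightarrow> complex \<Rightarrow> bool" where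
  "has_hankel_integral n g \<rho> v \<longleftrightarrow>
     ((\<lambda>r. g r * of_real r * of_real (bessel_J n (\<rho> * r))) has_integral v) {0..}"

text \<open>
  \<open>has_continuation P z v\<close>: the partial function \<open>w \<mapsto> u\<close> with graph \<open>P w u\<close>, which has to be defined
  on some nonempty open set, has a meromorphic continuation to the complex plane that is regular
  at \<open>z\<close> with value \<open>v\<close>.  A meromorphic function in the library's sense may have arbitrary values
  at poles and removable singularities, hence the separate analyticity condition at \<open>z\<close>.
\<close>

definition has_continuation :: "(complex \<Rightarrow> complex \<Rightarrow> bool) \<Rightarrow> complex \<Rightarrow> complex \<Rightarrow> bool" where
  "has_continuation P z v \<longleftrightarrow>
     (\<exists>F V. F meromorphic_on UNIV \<and> F analytic_on {z} \<and> F z = v \<and>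
            open V \<and> V \<noteq> {} \<and> (\<forall>w\<in>V. P w (F w)))"

text \<open>
  The Hankel transform: the convergent integral, or, for a multiple of a power \<open>r\<^bsup>-z\<^esup>\<close>, the analytic
  continuation of that integral in the exponent.  Only arguments \<open>r > 0\<close> and \<open>\<rho> > 0\<close> matter.
\<close>

inductive has_hankel_transform :: "nat \<Rightarrow> (real \<Rightarrow> complex) \<Rightarrow> (real \<Rightarrow> complex) \<Rightarrow> bool" for n where
  convergent:
    "(\<And>\<rho>. \<rho> > 0 \<Longrightarrow> has_hankel_integral n g \<rho> (G \<rho>)) \<Longrightarrow> has_hankel_transform n g G"
| continued:
    "(\<And>r. r > 0 \<Longrightarrow> g r = c * of_real r powr (-z)) \<Longrightarrow>
     (\<And>\<rho>. \<rho> > 0 \<Longrightarrow>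
        has_continuation (\<lambda>w. has_hankel_integral n (\<lambda>r. of_real r powr (-w)) \<rho>) z (L \<rho>)) \<Longrightarrow>
     (\<And>\<rho>. \<rho> > 0 \<Longrightarrow> G \<rho> = c * L \<rho>) \<Longrightarrow>
     has_hankel_transform n g G"

text \<open>
  \<open>has_multiplier_image a f h\<close>: the Fourier multiplier with symbol \<open>|\<xi>|\<^bsup>2a\<^esup>\<close> maps the function
  \<open>f = g(r) e\<^bsup>im\<theta>\<^esup>\<close> to \<open>h\<close>, as functions on the punctured plane.
\<close>

definition has_multiplier_image :: "real \<Rightarrow> (complex \<Rightarrow> complex) \<Rightarrow> (complex \<Rightarrow> complex) \<Rightarrow> bool" where
  "has_multiplier_image a f h \<longleftrightarrow>
     (\<exists>(m::int) g G k.
        (\<forall>x. x \<noteq> 0 \<longrightarrow> f x = g (cmod x) * cis (of_int m * Arg x)) \<and>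
        has_hankel_transform (nat \<bar>m\<bar>) g G \<and>
        has_hankel_transform (nat \<bar>m\<bar>) (\<lambda>\<rho>. of_real (\<rho> powr (2 * a)) * G \<rho>) k \<and>
        (\<forall>x. x \<noteq> 0 \<longrightarrow> h x = k (cmod x) * cis (of_int m * Arg x)))"

definition riesz_kernel :: "real \<Rightarrow> complex \<Rightarrow> real" where
  "riesz_kernel s x = Gamma (1 - s) / (4 powr s * pi * Gamma s) * cmod x powr (-(2 - 2 * s))"

definition has_frac_laplacian :: "real \<Rightarrow> (complex \<Rightarrow> complex) \<Rightarrow> (complex \<Rightarrow> complex) \<Rightarrow> bool" where
  "has_frac_laplacian s f h \<longleftrightarrow> has_multiplier_image s f h"

text \<open>The inverse operator is moreover the Riesz potential wherever the latter converges.\<close>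

definition has_inverse_frac_laplacian ::
    "real \<Rightarrow> (complex \<Rightarrow> complex) \<Rightarrow> (complex \<Rightarrow> complex) \<Rightarrow> bool" where
  "has_inverse_frac_laplacian s f h \<longleftrightarrow>
     has_multiplier_image (-s) f h \<and>
     (\<forall>x. x \<noteq> 0 \<longrightarrow> integrable lborel (\<lambda>y. of_real (riesz_kernel s (x - y)) * f y) \<longrightarrow>
          h x = (LINT y|lborel. of_real (riesz_kernel s (x - y)) * f y))"

definition power_mode :: "int \<Rightarrow> real \<Rightarrow> complex \<Rightarrow> complex" where
  "power_mode m a x = of_real (cmod x powr a) * cis (of_int m * Arg x)"

definition mu :: "nat \<Rightarrow> real \<Rightarrow> real \<Rightarrow> real" where
  "mu n s \<beta> = 2 powr (2 * s) *
     (Gamma ((real n + \<beta>) / 2 + s) * Gamma ((real n - \<beta>) / 2 + 1)) /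
     (Gamma ((real n + \<beta>) / 2) * Gamma ((real n - \<beta>) / 2 + 1 - s))"

end

theory Submission
  imports Defs
begin

text \<open>
  Both halves rest on Gaussian subordination.

  The continued Hankel transform of a power: inserting
  \<open>\<Gamma>(a) r\<^bsup>-2a\<^esup> = \<integral> p\<^bsup>a-1\<^esup> e\<^bsup>-p r\<^sup>2\<^esup> dp\<close> with \<open>a = (n + w)/2\<close> reduces \<open>\<integral> r\<^bsup>1-w\<^esup> J\<^sub>n(\<rho> r) dr\<close> to
  Weber's integral of \<open>r\<^bsup>n+1\<^esup> J\<^sub>n(\<rho> r) e\<^bsup>-p r\<^sup>2\<^esup>\<close>, which is summed term by term. The bound
  \<open>J\<^sub>n(x) = O(x\<^bsup>-1/2\<^esup>)\<close> makes the double integral absolutely convergent for \<open>3/2 < Re w < 2\<close>, an open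
  set that serves every \<open>n\<close>; the resulting quotient of Gamma functions is the continuation, and the
  multiplier formulas compose two such transforms.

  The Riesz potential: if it converges then \<open>\<beta> > 0\<close>. Writing
  \<open>\<Gamma>(1-s) |x-y|\<^bsup>2s-2\<^esup> = \<integral> t\<^bsup>-s\<^esup> e\<^bsup>-t |x-y|\<^sup>2\<^esup> dt\<close> and expanding the exponential at fixed \<open>t\<close>,
  rotation invariance leaves a single series, whose \<open>t\<close>-integral is Gauss's
  \<open>\<^sub>2F\<^sub>1\<close> at \<open>1\<close>.
\<close>

section \<open>Integrals of Gamma type\<close>

text \<open>The Riesz potential needs its own computation because an analytically continued
  transform says nothing about a convolution integral that happens to converge. Positivity drives
  that half. Convergence forces \<beta> > 0, and together with \<beta> < 2 - 2s this makes both (n -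
  \<beta>)/2 + 1 - s and (n + \<beta>)/2 positive, so that the series left over after the angular
  integration has nonnegative terms and its t-integral is a matter of Tonelli in the extended reals.
  The Hankel half has no such positivity, since J_n oscillates; there absolute convergence has to be
  paid for by decay of J_n, and the strip is what remains between integrability of r^(1-\<sigma>) at
  0 and of r^(1/2-\<sigma>) at infinity. The excluded parameter values are the poles that
  continuation may meet. For the operator itself they are the poles of the two Gamma factors in the
  numerator of \<open>mu\<close>; for the inverse those in the denominator, because replacing
  (\<beta>, s) by (\<beta> + 2s, -s) swaps numerator and denominator.\<close>

lemma has_bochner_integral_halfline_substitution:
  fixes f :: "real \<Rightarrow> 'a :: euclidean_space" and g g' :: "real \<Rightarrow> real"
  assumes f: "has_bochner_integral lborel (\<lambda>t. indicator {0<..} t *\<^sub>R f t) v"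
    and der: "\<And>t. t > 0 \<Longrightarrow> (g has_real_derivative g' t) (at t)"
    and g: "bij_betw g {0<..} {0<..}"
    and meas: "(\<lambda>t. indicator {0<..} t *\<^sub>R (\<bar>g' t\<bar> *\<^sub>R f (g t))) \<in> borel_measurable borel"
  shows "has_bochner_integral lborel (\<lambda>t. indicator {0<..} t *\<^sub>R (\<bar>g' t\<bar> *\<^sub>R f (g t))) v"
proof -
  have int: "set_integrable lborel {0<..} f" and v: "(LBINT t:{0<..}. f t) = v"
    using f by (auto simp: set_integrable_def set_lebesgue_integral_def has_bochner_integral_iff)
  have "f absolutely_integrable_on {0<..}"
    using int by (auto simp: set_integrable_def integrable_completion has_bochner_integral_iff)
  moreover have "integral {0<..} f = v"
    using set_borel_integral_eq_integral[OF int] v by simp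
  moreover have "g ` {0<..} = {0<..}" "inj_on g {0<..}"
    using g by (auto simp: bij_betw_def)
  ultimately have "(\<lambda>t. \<bar>g' t\<bar> *\<^sub>R f (g t)) absolutely_integrable_on {0<..} \<and>
      integral {0<..} (\<lambda>t. \<bar>g' t\<bar> *\<^sub>R f (g t)) = v"
    by (subst has_absolute_integral_change_of_variables_real)
       (auto intro: has_field_derivative_at_within der)
  \<comment> \<open>Absolute integrability refers to the completed measure; the Borel measurability
    in \<open>meas\<close> brings the result back to \<open>lborel\<close>.\<close>
  moreover from this have int': "set_integrable lborel {0<..} (\<lambda>t. \<bar>g' t\<bar> *\<^sub>R f (g t))"
    using meas by (simp add: set_integrable_def integrable_completion)
  ultimately show ?thesis
    using set_borel_integral_eq_integral(2)[OF int']
    by (simp add: has_bochner_integral_iff set_integrable_def set_lebesgue_integral_def)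
qed

text \<open>Euler's integral under the scaling t -> a t. Since a and t are positive reals, complex
  powers are multiplicative in them and a^(-z) factors out. This is the subordination formula; the
  complex exponent is needed for continuation in w.\<close>

lemma has_bochner_integral_Gamma_complex:
  assumes z: "Re z > 0" and a: "a > (0::real)"
  shows "has_bochner_integral lborel
           (\<lambda>t. indicator {0<..} t *\<^sub>R (of_real t powr (z - 1) * of_real (exp (- (a * t)))))
           (Gamma z * of_real a powr (- z))"
proof -
  have int: "(\<lambda>t. complex_of_real t powr (z - 1) / of_real (exp t)) absolutely_integrable_on {0<..}"
    using absolutely_integrable_Gamma_integral'[OF z] .
  have "has_bochner_integral lborel
          (\<lambda>t. indicator {0<..} t *\<^sub>R (complex_of_real t powr (z - 1) / of_real (exp t))) (Gamma z)"
  proof -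
    have int': "set_integrable lborel {0<..} (\<lambda>t. complex_of_real t powr (z - 1) / of_real (exp t))"
      using int unfolding set_integrable_def by (subst (asm) integrable_completion) measurable
    show ?thesis
      using int' set_borel_integral_eq_integral(2)[OF int'] integral_unique[OF Gamma_integral_complex'[OF z]]
      by (simp add: has_bochner_integral_iff set_integrable_def set_lebesgue_integral_def)
  qed
  then have "has_bochner_integral lborel (\<lambda>t. indicator {0<..} t *\<^sub>R
               (\<bar>a\<bar> *\<^sub>R (complex_of_real (a * t) powr (z - 1) / of_real (exp (a * t))))) (Gamma z)"
  proof (rule has_bochner_integral_halfline_substitution)
    show "bij_betw ((*) a) {0<..} {0<..}"
      using a by (intro bij_betwI[where g = "\<lambda>x. x / a"]) auto
  qed (auto intro!: derivative_eq_intros)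
  then have "has_bochner_integral lborel (\<lambda>t. of_real a powr (- z) * (indicator {0<..} t *\<^sub>R
     (\<bar>a\<bar> *\<^sub>R (complex_of_real (a * t) powr (z - 1) / of_real (exp (a * t))))))
     (of_real a powr (- z) * Gamma z)"
    by (rule has_bochner_integral_mult_right)
  also have "(\<lambda>t. of_real a powr (- z) * (indicator {0<..} t *\<^sub>R
     (\<bar>a\<bar> *\<^sub>R (complex_of_real (a * t) powr (z - 1) / of_real (exp (a * t)))))) =
     (\<lambda>t. indicator {0<..} t *\<^sub>R (of_real t powr (z - 1) * of_real (exp (- (a * t)))))"
  proof (rule ext)
    fix t :: real
    have "of_real a powr (- z) * (a *\<^sub>R (complex_of_real (a * t) powr (z - 1) / of_real (exp (a * t))))
        = of_real t powr (z - 1) * of_real (exp (- (a * t)))" if "t > 0"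
    proof -
      have "complex_of_real (a * t) powr (z - 1) = of_real a powr (z - 1) * of_real t powr (z - 1)"
        using a that by (simp add: powr_times_real)
      moreover have "complex_of_real a powr (- z) * (of_real a * of_real a powr (z - 1)) = 1"
        using a by (simp add: powr_diff powr_minus)
      ultimately have "of_real a powr (- z) * (of_real a * (complex_of_real (a * t) powr (z - 1)))
          = of_real t powr (z - 1)"
        by (metis mult.assoc mult.left_neutral)
      then show ?thesis
        by (simp add: scaleR_conv_of_real exp_minus divide_inverse mult.assoc
              flip: exp_of_real)
    qed
    then show "of_real a powr (- z) * (indicator {0<..} t *\<^sub>R
       (\<bar>a\<bar> *\<^sub>R (complex_of_real (a * t) powr (z - 1) / of_real (exp (a * t))))) =
       indicator {0<..} t *\<^sub>R (of_real t powr (z - 1) * of_real (exp (- (a * t))))"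
      using a by (simp add: indicator_def)
  qed
  finally show ?thesis by (simp add: mult.commute)
qed

text \<open>The previous integral under t -> 1/t, whose Jacobian 1/t^2 turns t^(1-z) into t^(-z-1).
  Weber's integral leaves a factor exp(-\<rho>^2/(4p)), so the final p-integral has this
  shape.\<close>

lemma has_bochner_integral_inverse_Gamma_complex:
  assumes z: "Re z > 0" and a: "a > (0::real)"
  shows "has_bochner_integral lborel
           (\<lambda>t. indicator {0<..} t *\<^sub>R (of_real t powr (- z - 1) * of_real (exp (- (a / t)))))
           (Gamma z * of_real a powr (- z))"
proof -
  have "has_bochner_integral lborel (\<lambda>t. indicator {0<..} t *\<^sub>R (\<bar>(- (1 / t ^ 2))\<bar> *\<^sub>R
          (complex_of_real (1 / t) powr (z - 1) * of_real (exp (- (a * (1 / t)))))))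
          (Gamma z * of_real a powr (- z))"
  proof (rule has_bochner_integral_halfline_substitution[OF has_bochner_integral_Gamma_complex[OF assms]])
    show "bij_betw (\<lambda>t. 1 / t) {0<..} {0::real<..}"
      by (intro bij_betwI[where g = "\<lambda>x. 1 / x"]) auto
    show "((\<lambda>t. 1 / t) has_real_derivative (- (1 / t ^ 2))) (at t)" if "t > 0" for t :: real
      using that by (auto intro!: derivative_eq_intros simp: power2_eq_square)
    show "(\<lambda>t. indicator {0<..} t *\<^sub>R (\<bar>(- (1 / t ^ 2))\<bar> *\<^sub>R
          (complex_of_real (1 / t) powr (z - 1) * of_real (exp (- (a * (1 / t)))))))
          \<in> borel_measurable borel"
      by measurable
  qed
  also have "(\<lambda>t. indicator {0<..} t *\<^sub>R (\<bar>(- (1 / t ^ 2))\<bar> *\<^sub>R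
          (complex_of_real (1 / t) powr (z - 1) * of_real (exp (- (a * (1 / t))))))) =
     (\<lambda>t. indicator {0<..} t *\<^sub>R (of_real t powr (- z - 1) * of_real (exp (- (a / t)))))"
  proof (rule ext)
    fix t :: real
    have "complex_of_real (1 / t) powr (z - 1) / of_real (t ^ 2) = of_real t powr (- z - 1)" if "t > 0"
    proof -
      have "complex_of_real (t ^ 2) = exp (of_real (2 * ln t))"
        using that exp_of_real[of "2 * ln t", where 'a = complex] by (simp add: exp_double)
      moreover have "Ln (complex_of_real (1 / t)) = - of_real (ln t)"
        using that by (subst Ln_of_real) (auto simp: ln_div)
      moreover have "(z - 1) * - of_real (ln t) - of_real (2 * ln t) = (- z - 1) * complex_of_real (ln t)"
        by (simp add: algebra_simps)
      ultimately show ?thesis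
        using that by (simp add: powr_def Ln_of_real flip: exp_diff)
    qed
    then show "indicator {0<..} t *\<^sub>R (\<bar>(- (1 / t ^ 2))\<bar> *\<^sub>R
          (complex_of_real (1 / t) powr (z - 1) * of_real (exp (- (a * (1 / t)))))) =
      indicator {0<..} t *\<^sub>R (of_real t powr (- z - 1) * of_real (exp (- (a / t))))"
      by (auto simp: indicator_def scaleR_conv_of_real field_simps)
  qed
  finally show ?thesis .
qed

lemma has_bochner_integral_Gamma_real:
  assumes z: "z > 0" and a: "a > (0::real)"
  shows "has_bochner_integral lborel
           (\<lambda>t. indicator {0<..} t * (t powr (z - 1) * exp (- (a * t)))) (Gamma z * a powr (- z))"
proof -
  have "has_bochner_integral lborel (\<lambda>t. Re (indicator {0<..} t *\<^sub>R 
          (of_real t powr (of_real z - 1) * of_real (exp (- (a * t))))))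
          (Re (Gamma (of_real z) * of_real a powr (- of_real z)))"
    by (rule has_bochner_integral_bounded_linear[OF bounded_linear_Re
          has_bochner_integral_Gamma_complex]) (use assms in auto)
  also have "Re (Gamma (of_real z) * of_real a powr (- of_real z)) = Gamma z * a powr (- z)"
    using a by (simp add: Gamma_complex_of_real powr_of_real flip: of_real_minus of_real_mult)
  also have "(\<lambda>t. Re (indicator {0<..} t *\<^sub>R 
          (of_real t powr (of_real z - 1) * of_real (exp (- (a * t)))))) =
      (\<lambda>t. indicator {0<..} t * (t powr (z - 1) * exp (- (a * t))))"
  proof -
    have "Re (of_real t powr (of_real z - 1) * of_real (exp (- (a * t)))) = t powr (z - 1) * exp (- (a * t))"
      if "t > 0" for t :: real
      using powr_of_real[of t "z - 1"] that
      by (simp del: exp_of_real of_real_mult flip: of_real_mult)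
    then show ?thesis by (auto simp: fun_eq_iff indicator_def)
  qed
  finally show ?thesis .
qed

lemma nn_integral_Gamma:
  assumes z: "z > 0" and a: "a > (0::real)"
  shows "(\<integral>\<^sup>+t. ennreal (indicator {0<..} t * (t powr (z - 1) * exp (- (a * t)))) \<partial>lborel) =
           ennreal (Gamma z * a powr (- z))"
  using has_bochner_integral_Gamma_real[OF assms] 
  by (subst nn_integral_eq_integral) (auto simp: has_bochner_integral_iff)

text \<open>The substitution t = r^2 in Euler's integral for \<Gamma>(k + 1); only odd powers of r
  arise, and they produce the factorials that cancel those of the Bessel series.\<close>

lemma has_bochner_integral_gaussian_moment_halfline:
  assumes p: "p > (0::real)"
  shows "has_bochner_integral lborel
           (\<lambda>r. indicator {0<..} r * (r ^ (2 * k + 1) * exp (- (p * r ^ 2))))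
           (fact k / (2 * p ^ (k + 1)))"
proof -
  have "has_bochner_integral lborel (\<lambda>r. indicator {0<..} r *\<^sub>R (\<bar>2 * r\<bar> *\<^sub>R
          ((r ^ 2) powr (real (k + 1) - 1) * exp (- (p * r ^ 2)))))
          (Gamma (real (k + 1)) * p powr (- real (k + 1)))"
  proof (rule has_bochner_integral_halfline_substitution
      [where g = "\<lambda>r. r ^ 2" and f = "\<lambda>t. t powr (real (k + 1) - 1) * exp (- (p * t))"])
    show "bij_betw (\<lambda>r. r ^ 2) {0<..} {0::real<..}"
      by (intro bij_betwI[where g = sqrt]) auto
    show "has_bochner_integral lborel
           (\<lambda>t. indicator {0<..} t *\<^sub>R (t powr (real (k + 1) - 1) * exp (- (p * t))))
           (Gamma (real (k + 1)) * p powr (- real (k + 1)))"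
      using has_bochner_integral_Gamma_real[of "real (k + 1)" p] p by simp
  qed (auto intro!: derivative_eq_intros)
  then have "has_bochner_integral lborel (\<lambda>r. (1 / 2) * (indicator {0<..} r *\<^sub>R (\<bar>2 * r\<bar> *\<^sub>R
          ((r ^ 2) powr (real (k + 1) - 1) * exp (- (p * r ^ 2))))))
          ((1 / 2) * (Gamma (real (k + 1)) * p powr (- real (k + 1))))"
    by (rule has_bochner_integral_mult_right)
  also have "(\<lambda>r. (1 / 2) * (indicator {0<..} r *\<^sub>R (\<bar>2 * r\<bar> *\<^sub>R
          ((r ^ 2) powr (real (k + 1) - 1) * exp (- (p * r ^ 2)))))) =
      (\<lambda>r. indicator {0<..} r * (r ^ (2 * k + 1) * exp (- (p * r ^ 2))))"
    by (auto simp: fun_eq_iff indicator_def powr_realpow power_mult)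
  also have "(1 / 2) * (Gamma (real (k + 1)) * p powr (- real (k + 1))) = fact k / (2 * p ^ (k + 1))"
  proof -
    have "Gamma (real (k + 1)) = fact k"
      using Gamma_fact[of k] by (simp add: add.commute)
    then show ?thesis
      using p by (simp only: powr_minus powr_realpow) (simp add: field_simps)
  qed
  finally show ?thesis .
qed

text \<open>Euler's integral representation: \<Gamma>(b+k)/\<Gamma>(c+k) is 1/\<Gamma>(c-b) times a
  Beta integral containing u^k, the sum over k is the binomial series of \<Gamma>(a)(1-u)^(-a), and
  a second Beta integral remains, convergent at u = 1 because c > a + b. All terms are nonnegative,
  so sum and integral commute in \<open>ennreal\<close>, which is also the form in which the Riesz
  computation consumes the result.\<close>

theorem suminf_Gamma_Gauss:
  assumes a: "a > 0" and b: "b > 0" and c: "c > a + (b :: real)"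
  shows "(\<Sum>k. ennreal (Gamma (a + real k) * Gamma (b + real k) / (fact k * Gamma (c + real k)))) =
           ennreal (Gamma a * Gamma b * Gamma (c - a - b) / (Gamma (c - a) * Gamma (c - b)))"
proof -
  have beta: "(\<integral>\<^sup>+u. ennreal (indicator {0<..<1} u * (u powr (x - 1) * (1 - u) powr (y - 1))) \<partial>lborel) =
      ennreal (Gamma x * Gamma y / Gamma (x + y))" if "x > 0" "y > 0" for x y :: real
    using nn_integral_has_integral_lebesgue[of "{0<..<1}" "\<lambda>u. u powr (x - 1) * (1 - u) powr (y - 1)" "Beta x y"]
      has_integral_Beta_real[OF that] by (simp add: has_integral_Icc_iff_Ioo Beta_def)
  have binom: "(\<lambda>k. Gamma (a + real k) / fact k * u ^ k) sums (Gamma a * (1 - u) powr (- a))"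
    if "0 < u" "u < 1" for u
  proof -
    have "(\<lambda>k. Gamma a * (((- a) gchoose k) * (- u) ^ k)) sums (Gamma a * (1 + - u) powr (- a))"
      using that by (intro sums_mult gen_binomial_real) auto
    moreover have "Gamma a * (((- a) gchoose k) * (- u) ^ k) = Gamma (a + real k) / fact k * u ^ k" for k
    proof -
      have "a \<notin> \<int>\<^sub>\<le>\<^sub>0" using a by (auto elim!: nonpos_Ints_cases)
      then have "Gamma (a + real k) = Gamma a * pochhammer a k"
        using a by (simp add: pochhammer_Gamma Gamma_eq_zero_iff)
      moreover have "((- a) gchoose k) * (- u) ^ k = pochhammer a k / fact k * u ^ k"
        by (simp add: gbinomial_pochhammer power_minus[of u k])
      ultimately show ?thesis by simp
    qed
    ultimately show ?thesis by simp
  qed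
  define G where "G = ennreal (1 / Gamma (c - b))"
  have "(\<Sum>k. ennreal (Gamma (a + real k) * Gamma (b + real k) / (fact k * Gamma (c + real k)))) =
    (\<Sum>k. \<integral>\<^sup>+u. G * ennreal (indicator {0<..<1} u * (Gamma (a + real k) / fact k * u ^ k) * 
         (u powr (b - 1) * (1 - u) powr (c - b - 1))) \<partial>lborel)"
  proof (rule suminf_cong)
    fix k
    have "(\<integral>\<^sup>+u. G * ennreal (indicator {0<..<1} u * (Gamma (a + real k) / fact k * u ^ k) * 
         (u powr (b - 1) * (1 - u) powr (c - b - 1))) \<partial>lborel) =
      (\<integral>\<^sup>+u. G * ennreal (Gamma (a + real k) / fact k) * ennreal (indicator {0<..<1} u * 
         (u powr (b + real k - 1) * (1 - u) powr (c - b - 1))) \<partial>lborel)"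
    proof (rule nn_integral_cong)
      fix u :: real
      have "u powr (b + real k - 1) = u ^ k * u powr (b - 1)" if "0 < u"
        using that powr_add[of u "real k" "b - 1"] by (simp add: powr_realpow algebra_simps)
      moreover have "Gamma (a + real k) > 0"
        using a by (intro Gamma_real_pos) auto
      ultimately show "G * ennreal (indicator {0<..<1} u * (Gamma (a + real k) / fact k * u ^ k) * 
           (u powr (b - 1) * (1 - u) powr (c - b - 1))) =
         G * ennreal (Gamma (a + real k) / fact k) * ennreal (indicator {0<..<1} u * 
           (u powr (b + real k - 1) * (1 - u) powr (c - b - 1)))"
        by (simp add: indicator_def mult.assoc flip: ennreal_mult)
    qed
    also have "\<dots> = G * ennreal (Gamma (a + real k) / fact k) * 
         ennreal (Gamma (b + real k) * Gamma (c - b) / Gamma (b + real k + (c - b)))"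
      using a b c by (subst nn_integral_cmult) (auto simp: beta)
    also have "\<dots> = ennreal (Gamma (a + real k) * Gamma (b + real k) / (fact k * Gamma (c + real k)))"
    proof -
      have "Gamma (c - b) > 0" "Gamma (a + real k) > 0" "Gamma (b + real k) > 0" "Gamma (c + real k) > 0"
        using a b c by (auto intro!: Gamma_real_pos)
      then show ?thesis
        by (simp add: G_def field_simps flip: ennreal_mult)
    qed
    finally show "ennreal (Gamma (a + real k) * Gamma (b + real k) / (fact k * Gamma (c + real k))) =
      (\<integral>\<^sup>+u. G * ennreal (indicator {0<..<1} u * (Gamma (a + real k) / fact k * u ^ k) * 
         (u powr (b - 1) * (1 - u) powr (c - b - 1))) \<partial>lborel)" ..
  qed
  also have "\<dots> = (\<integral>\<^sup>+u. (\<Sum>k. G * ennreal (indicator {0<..<1} u * (Gamma (a + real k) / fact k * u ^ k) * 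
         (u powr (b - 1) * (1 - u) powr (c - b - 1)))) \<partial>lborel)"
    by (rule nn_integral_suminf[symmetric]) measurable
  also have "\<dots> = (\<integral>\<^sup>+u. G * ennreal (Gamma a) * ennreal (indicator {0<..<1} u * 
       (u powr (b - 1) * (1 - u) powr (c - a - b - 1))) \<partial>lborel)"
  proof (rule nn_integral_cong)
    fix u :: real
    show "(\<Sum>k. G * ennreal (indicator {0<..<1} u * (Gamma (a + real k) / fact k * u ^ k) * 
         (u powr (b - 1) * (1 - u) powr (c - b - 1)))) = G * ennreal (Gamma a) * ennreal (indicator {0<..<1} u * 
       (u powr (b - 1) * (1 - u) powr (c - a - b - 1)))"
    proof (cases "u \<in> {0<..<1}")
      case True
      then have u: "0 < u" "u < 1" by auto
      have "(\<lambda>k. Gamma (a + real k) / fact k * u ^ k * (u powr (b - 1) * (1 - u) powr (c - b - 1))) sums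
        (Gamma a * (1 - u) powr (- a) * (u powr (b - 1) * (1 - u) powr (c - b - 1)))"
        by (intro sums_mult2 binom u)
      also have "Gamma a * (1 - u) powr (- a) * (u powr (b - 1) * (1 - u) powr (c - b - 1)) =
         Gamma a * (u powr (b - 1) * (1 - u) powr (c - a - b - 1))"
        by (simp add: algebra_simps flip: powr_add)
      finally have "(\<lambda>k. Gamma (a + real k) / fact k * u ^ k * (u powr (b - 1) * (1 - u) powr (c - b - 1))) sums
         (Gamma a * (u powr (b - 1) * (1 - u) powr (c - a - b - 1)))" .
      then have "(\<Sum>k. ennreal (Gamma (a + real k) / fact k * u ^ k * (u powr (b - 1) * (1 - u) powr (c - b - 1)))) =
         ennreal (Gamma a * (u powr (b - 1) * (1 - u) powr (c - a - b - 1)))"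
        using a u by (intro sums_unique[symmetric], subst sums_ennreal)
           (auto intro!: mult_nonneg_nonneg divide_nonneg_nonneg Gamma_real_nonneg)
      then show ?thesis
        using u a by (simp add: ennreal_suminf_cmult ennreal_mult Gamma_real_nonneg mult.assoc)
    qed simp
  qed
  also have "\<dots> = G * ennreal (Gamma a) * ennreal (Gamma b * Gamma (c - a - b) / Gamma (b + (c - a - b)))"
    using a b c by (subst nn_integral_cmult) (auto simp: beta)
  also have "\<dots> = ennreal (Gamma a * Gamma b * Gamma (c - a - b) / (Gamma (c - a) * Gamma (c - b)))"
  proof -
    have "Gamma (c - b) > 0" "Gamma a > 0" "Gamma b > 0" "Gamma (c - a - b) > 0" "Gamma (c - a) > 0"
      using a b c by (auto intro!: Gamma_real_pos)
    then show ?thesis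
      by (simp add: G_def field_simps flip: ennreal_mult)
  qed
  finally show ?thesis .
qed

section \<open>Rotation invariance in the plane\<close>

text \<open>A disc of squared radius a has area \<pi> a, and the sets \<open>{..a}\<close> generate
  the Borel sets. Working with the squared modulus instead of the modulus makes the density constant
  and turns Gaussians into plain exponentials.\<close>

lemma distr_cmod_square:
  "distr (lborel :: complex measure) borel (\<lambda>y. (cmod y)\<^sup>2) =
     density lborel (\<lambda>u. ennreal pi * indicator {0<..} u)"
proof (rule measure_eqI_generator_eq[where \<Omega> = UNIV and E = "range (\<lambda>a::real. {..a})" and A = "\<lambda>n. {..real n}"])
  show "Int_stable (range (\<lambda>a::real. {..a}))"
    by (auto simp: Int_stable_def)
  show "sets (distr (lborel :: complex measure) borel (\<lambda>y. (cmod y)\<^sup>2)) = sigma_sets UNIV (range (\<lambda>a::real. {..a}))"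
    "sets (density lborel (\<lambda>u. ennreal pi * indicator {0<..} u)) = sigma_sets UNIV (range (\<lambda>a::real. {..a}))"
    by (simp_all add: borel_eq_atMost)
  have rhs: "emeasure (density lborel (\<lambda>u. ennreal pi * indicator {0<..} u)) {..a} = ennreal (pi * max 0 a)" for a :: real
  proof -
    have "emeasure (density lborel (\<lambda>u. ennreal pi * indicator {0<..} u)) {..a} =
       (\<integral>\<^sup>+u. ennreal pi * indicator {0<..a} u \<partial>lborel)"
      by (subst emeasure_density) (auto intro!: nn_integral_cong simp: indicator_def)
    also have "\<dots> = ennreal (pi * max 0 a)"
      by (subst nn_integral_cmult_indicator) (auto simp: ennreal_mult' max_def)
    finally show ?thesis .
  qed
  have lhs: "emeasure (distr (lborel :: complex measure) borel (\<lambda>y. (cmod y)\<^sup>2)) {..a} = ennreal (pi * max 0 a)" for a :: real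
  proof (cases "a < 0")
    case True
    then have "(\<lambda>y. (cmod y)\<^sup>2) -` {..a} = {}"
      by auto (smt (verit) zero_le_power2)
    then show ?thesis
      using True by (simp add: emeasure_distr max_def)
  next
    case False
    then have "(\<lambda>y. (cmod y)\<^sup>2) -` {..a} = cball 0 (sqrt a)"
      by (auto simp: real_le_rsqrt sqrt_le_D)
         (metis abs_norm_cancel sqrt_ge_absD)
    then show ?thesis
      using False by (simp add: emeasure_distr emeasure_cball unit_ball_vol_numeral eval_unit_ball_vol max_def)
  qed
  show "emeasure (distr (lborel :: complex measure) borel (\<lambda>y. (cmod y)\<^sup>2)) X =
      emeasure (density lborel (\<lambda>u. ennreal pi * indicator {0<..} u)) X"
    if "X \<in> range (\<lambda>a::real. {..a})" for X
    using that lhs rhs by auto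
  show "(\<Union>i. {..real i}) = UNIV"
    by (auto intro: real_arch_simple)
  show "emeasure (distr (lborel :: complex measure) borel (\<lambda>y. (cmod y)\<^sup>2)) {..real i} \<noteq> \<infinity>" for i
    by (simp add: lhs)
qed auto

lemma nn_integral_radial:
  assumes [measurable]: "f \<in> borel_measurable (borel :: real measure)"
  shows "(\<integral>\<^sup>+y. f ((cmod y)\<^sup>2) \<partial>lborel) = ennreal pi * (\<integral>\<^sup>+u. indicator {0<..} u * f u \<partial>lborel)"
proof -
  have "(\<integral>\<^sup>+y. f ((cmod y)\<^sup>2) \<partial>lborel) = (\<integral>\<^sup>+u. f u \<partial>distr lborel borel (\<lambda>y. (cmod y)\<^sup>2))"
    by (subst nn_integral_distr) auto
  also have "\<dots> = (\<integral>\<^sup>+u. ennreal pi * (indicator {0<..} u * f u) \<partial>lborel)"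
    unfolding distr_cmod_square by (subst nn_integral_density) (auto simp: mult.assoc)
  also have "\<dots> = ennreal pi * (\<integral>\<^sup>+u. indicator {0<..} u * f u \<partial>lborel)"
    by (subst nn_integral_cmult) auto
  finally show ?thesis .
qed

section \<open>Plane Lebesgue measure as a product measure; shears and rotations\<close>

lemma Complex_measurable [measurable]:
  "(\<lambda>(x, y). Complex x y) \<in> borel \<Otimes>\<^sub>M borel \<rightarrow>\<^sub>M borel"
  unfolding Complex_eq by measurable

text \<open>Lebesgue measure is determined by its values on boxes, and a complex box is a product of
  two intervals. This gives access to iterated integrals in the real and imaginary parts.\<close>

lemma lborel_complex_eq:
  "(lborel :: complex measure) = distr (lborel \<Otimes>\<^sub>M lborel) borel (\<lambda>(x, y). Complex x y)"
proof (rule lborel_eqI)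
  fix l u :: complex
  assume le: "\<And>b. b \<in> Basis \<Longrightarrow> l \<bullet> b \<le> u \<bullet> b"
  have "(\<lambda>(x, y). Complex x y) -` box l u = {Re l<..<Re u} \<times> {Im l<..<Im u}"
    by (auto simp: box_def Basis_complex_def)
  moreover have "emeasure (lborel \<Otimes>\<^sub>M lborel) ({Re l<..<Re u} \<times> {Im l<..<Im u}) =
     ennreal (Re u - Re l) * ennreal (Im u - Im l)"
    using le[of 1] le[of \<i>] by (subst lborel.emeasure_pair_measure_Times) (auto simp: Basis_complex_def)
  ultimately show "emeasure (distr (lborel \<Otimes>\<^sub>M lborel) borel (\<lambda>(x, y). Complex x y)) (box l u) =
      ennreal (\<Prod>b\<in>Basis. (u - l) \<bullet> b)"
    using le[of 1] le[of \<i>]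
    by (simp add: emeasure_distr Basis_complex_def space_pair_measure flip: ennreal_mult)
qed simp

lemma nn_integral_lborel_complex:
  assumes [measurable]: "f \<in> borel_measurable borel"
  shows "(\<integral>\<^sup>+z. f z \<partial>lborel) = (\<integral>\<^sup>+x. \<integral>\<^sup>+y. f (Complex x y) \<partial>lborel \<partial>lborel)"
    and "(\<integral>\<^sup>+z. f z \<partial>lborel) = (\<integral>\<^sup>+y. \<integral>\<^sup>+x. f (Complex x y) \<partial>lborel \<partial>lborel)"
proof -
  have *: "(\<lambda>(x, y). f (Complex x y)) \<in> borel_measurable (lborel \<Otimes>\<^sub>M lborel)"
    using measurable_compose[OF Complex_measurable assms] by (simp add: case_prod_unfold)
  have "(\<integral>\<^sup>+z. f z \<partial>lborel) = (\<integral>\<^sup>+p. (case p of (x, y) \<Rightarrow> f (Complex x y)) \<partial>(lborel \<Otimes>\<^sub>M lborel))"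
    by (subst lborel_complex_eq, subst nn_integral_distr) (auto simp: case_prod_unfold)
  then show "(\<integral>\<^sup>+z. f z \<partial>lborel) = (\<integral>\<^sup>+x. \<integral>\<^sup>+y. f (Complex x y) \<partial>lborel \<partial>lborel)"
    "(\<integral>\<^sup>+z. f z \<partial>lborel) = (\<integral>\<^sup>+y. \<integral>\<^sup>+x. f (Complex x y) \<partial>lborel \<partial>lborel)"
    using lborel.nn_integral_fst[OF *] lborel_pair.nn_integral_snd[OF *] by simp_all
qed

text \<open>With the fixed coordinate held constant, a shear translates the other one; integrating
  the moving coordinate first reduces the claim to translation invariance on the line.\<close>

lemma nn_integral_shear:
  assumes [measurable]: "f \<in> borel_measurable borel"
  shows "(\<integral>\<^sup>+z. f (z + of_real (a * Im z)) \<partial>lborel) = (\<integral>\<^sup>+z. f z \<partial>lborel)"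
    and "(\<integral>\<^sup>+z. f (z + \<i> * of_real (a * Re z)) \<partial>lborel) = (\<integral>\<^sup>+z. f z \<partial>lborel)"
proof -
  have [measurable]: "(\<lambda>x. f (Complex x y)) \<in> borel_measurable borel"
    "(\<lambda>x. f (Complex y x)) \<in> borel_measurable borel" for y
    by (simp_all add: Complex_eq)
  have "(\<integral>\<^sup>+z. f (z + of_real (a * Im z)) \<partial>lborel) = (\<integral>\<^sup>+y. \<integral>\<^sup>+x. f (Complex (a * y + 1 * x) y) \<partial>lborel \<partial>lborel)"
    by (subst nn_integral_lborel_complex(2)) (simp_all add: Complex_eq algebra_simps)
  also have "\<dots> = (\<integral>\<^sup>+y. \<integral>\<^sup>+x. f (Complex x y) \<partial>lborel \<partial>lborel)"
  proof (rule nn_integral_cong)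
    fix y show "(\<integral>\<^sup>+x. f (Complex (a * y + 1 * x) y) \<partial>lborel) = (\<integral>\<^sup>+x. f (Complex x y) \<partial>lborel)"
      using nn_integral_real_affine[of "\<lambda>x. f (Complex x y)" 1 "a * y"] by simp
  qed
  finally show "(\<integral>\<^sup>+z. f (z + of_real (a * Im z)) \<partial>lborel) = (\<integral>\<^sup>+z. f z \<partial>lborel)"
    by (subst (2) nn_integral_lborel_complex(2)) auto
  have "(\<integral>\<^sup>+z. f (z + \<i> * of_real (a * Re z)) \<partial>lborel) = (\<integral>\<^sup>+x. \<integral>\<^sup>+y. f (Complex x (a * x + 1 * y)) \<partial>lborel \<partial>lborel)"
    by (subst nn_integral_lborel_complex(1)) (simp_all add: Complex_eq algebra_simps)
  also have "\<dots> = (\<integral>\<^sup>+x. \<integral>\<^sup>+y. f (Complex x y) \<partial>lborel \<partial>lborel)"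
  proof (rule nn_integral_cong)
    fix x show "(\<integral>\<^sup>+y. f (Complex x (a * x + 1 * y)) \<partial>lborel) = (\<integral>\<^sup>+y. f (Complex x y) \<partial>lborel)"
      using nn_integral_real_affine[of "\<lambda>y. f (Complex x y)" 1 "a * x"] by simp
  qed
  finally show "(\<integral>\<^sup>+z. f (z + \<i> * of_real (a * Re z)) \<partial>lborel) = (\<integral>\<^sup>+z. f z \<partial>lborel)"
    by (subst (2) nn_integral_lborel_complex(1)) auto
qed

text \<open>A rotation by an angle \<open>\<theta> \<noteq> \<pi>\<close> is a product of three shears.\<close>

lemma distr_rotation:
  assumes "cos \<theta> \<noteq> -1"
  shows "distr lborel borel ((*) (cis \<theta>)) = (lborel :: complex measure)"
proof (rule measure_eqI)
  fix A :: "complex set"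
  assume "A \<in> sets (distr lborel borel ((*) (cis \<theta>)))"
  then have [measurable]: "A \<in> sets borel" by simp
  \<comment> \<open>\<open>t\<close> is tan(\<theta>/2), with its pole at the excluded angle. Shears
    by -t, sin \<theta> and -t compose to the rotation; the facts \<open>1\<close> and
    \<open>2\<close> are the half-angle identities behind this.\<close>
  define t where "t = sin \<theta> / (1 + cos \<theta>)"
  define f :: "complex \<Rightarrow> ennreal" where "f = indicator A"
  have f [measurable]: "f \<in> borel_measurable borel" by (simp add: f_def)
  define S where "S z = z + of_real (- t * Im z)" for z
  define T where "T z = z + \<i> * of_real (sin \<theta> * Re z)" for z
  have [measurable]: "S \<in> borel_measurable borel" "T \<in> borel_measurable borel"
    unfolding S_def T_def by measurable
  have ne: "1 + cos \<theta> \<noteq> 0" using assms by auto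
  have 1: "1 - t * sin \<theta> = cos \<theta>"
  proof -
    have "(1 + cos \<theta>) * (1 - t * sin \<theta>) = (1 + cos \<theta>) - (sin \<theta>)\<^sup>2"
      using ne by (simp add: t_def field_simps power2_eq_square)
    also have "\<dots> = (1 + cos \<theta>) * cos \<theta>"
      by (simp add: sin_squared_eq algebra_simps power2_eq_square)
    finally show ?thesis using ne by simp
  qed
  have 2: "t * (1 + cos \<theta>) = sin \<theta>" using ne by (simp add: t_def)
  have rot: "cis \<theta> * z = S (T (S z))" for z
  proof (rule complex_eqI)
    have "Re (S (T (S z))) = (1 - t * sin \<theta>) * Re z - t * (1 + (1 - t * sin \<theta>)) * Im z"
      by (simp add: S_def T_def algebra_simps)
    then show "Re (cis \<theta> * z) = Re (S (T (S z)))"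
      unfolding 1 2 by simp
    have "Im (S (T (S z))) = sin \<theta> * Re z + (1 - t * sin \<theta>) * Im z"
      by (simp add: S_def T_def algebra_simps)
    then show "Im (cis \<theta> * z) = Im (S (T (S z)))"
      unfolding 1 by simp
  qed
  have "emeasure (distr lborel borel ((*) (cis \<theta>))) A = (\<integral>\<^sup>+z. f (S (T (S z))) \<partial>lborel)"
    by (subst nn_integral_indicator[symmetric], simp, subst nn_integral_distr) (simp_all add: f_def rot)
  also have "\<dots> = (\<integral>\<^sup>+z. f (S (T z)) \<partial>lborel)"
    using nn_integral_shear(1)[of "\<lambda>z. f (S (T z))" "- t"] unfolding S_def[symmetric] by simp
  also have "\<dots> = (\<integral>\<^sup>+z. f (S z) \<partial>lborel)"
    using nn_integral_shear(2)[of "\<lambda>z. f (S z)" "sin \<theta>"] unfolding T_def[symmetric] by simp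
  also have "\<dots> = (\<integral>\<^sup>+z. f z \<partial>lborel)"
    using nn_integral_shear(1)[of "\<lambda>z. f z" "- t"] unfolding S_def[symmetric] by simp
  finally show "emeasure (distr lborel borel ((*) (cis \<theta>))) A = emeasure lborel A"
    by (simp add: f_def)
qed simp

section \<open>Orthogonality of the angular modes\<close>

lemma sgn_complex_measurable [measurable]: "(sgn :: complex \<Rightarrow> complex) \<in> borel_measurable borel"
  unfolding sgn_div_norm[abs_def] by measurable

lemma sgn_mult_cnj: "z \<noteq> 0 \<Longrightarrow> sgn z * cnj (sgn z) = 1"
  by (simp add: norm_sgn flip: complex_norm_square)

lemma cnj_measurable [measurable]: "cnj \<in> borel_measurable borel"
  by (intro borel_measurable_continuous_onI continuous_intros)

text \<open>For a \<noteq> b, rotating the variable by \<theta> shows that the integral equals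
  itself times exp(i(a-b)\<theta>), so it vanishes once this factor differs from 1. For a = b the
  phases cancel away from the origin.\<close>

lemma integral_radial_phase:
  assumes F [measurable]: "F \<in> borel_measurable borel"
  shows "(LINT y|lborel. complex_of_real (F (cmod y)) * (sgn y ^ a * cnj (sgn y) ^ b)) =
           (if a = b then of_real (LINT y|lborel. F (cmod y)) else 0)"
proof (cases "a = b")
  case True
  have "(LINT y|lborel. complex_of_real (F (cmod y)) * (sgn y ^ a * cnj (sgn y) ^ b)) =
     (LINT y|lborel. complex_of_real (F (cmod y)))"
  proof (rule integral_cong_AE)
    show "AE y in lborel. complex_of_real (F (cmod y)) * (sgn y ^ a * cnj (sgn y) ^ b) = of_real (F (cmod y))"
      using AE_lborel_singleton[of 0]
    proof eventually_elim
      case (elim y)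
      then have "sgn y ^ a * cnj (sgn y) ^ b = 1"
        unfolding True power_mult_distrib[symmetric] by (simp only: sgn_mult_cnj[OF elim] power_one)
      then show ?case by (simp only: mult_1_right)
    qed
  qed measurable
  then show ?thesis using True by simp
next
  case False
  define d where "d = \<bar>real a - real b\<bar>"
  have d: "d > 0" using False by (simp add: d_def)
  \<comment> \<open>The choice keeps 0 < |a - b| \<theta> < \<pi>, so the phase factor is not 1, and
    \<theta> < \<pi>, so the rotation is one that \<open>distr_rotation\<close> covers.\<close>
  define \<theta> where "\<theta> = pi / (d + 1)"
  have \<theta>: "0 < \<theta>" "\<theta> < pi"
    using d by (simp_all add: \<theta>_def divide_less_eq)
  define I where "I = (LINT y|lborel. complex_of_real (F (cmod y)) * (sgn y ^ a * cnj (sgn y) ^ b))"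
  have "cos \<theta> \<noteq> -1"
    using cos_monotone_0_pi[of \<theta> pi] \<theta> by simp
  then have "I = (LINT y|distr lborel borel ((*) (cis \<theta>)). complex_of_real (F (cmod y)) * (sgn y ^ a * cnj (sgn y) ^ b))"
    by (simp add: distr_rotation I_def)
  also have "\<dots> = (LINT y|lborel. (cis \<theta> ^ a * cnj (cis \<theta>) ^ b) * (complex_of_real (F (cmod y)) * (sgn y ^ a * cnj (sgn y) ^ b)))"
  proof (subst integral_distr)
    have "sgn (cis \<theta>) = cis \<theta>" by (simp add: sgn_div_norm)
    then show "(LINT y|lborel. complex_of_real (F (cmod (cis \<theta> * y))) * (sgn (cis \<theta> * y) ^ a * cnj (sgn (cis \<theta> * y)) ^ b)) =
        (LINT y|lborel. (cis \<theta> ^ a * cnj (cis \<theta>) ^ b) * (complex_of_real (F (cmod y)) * (sgn y ^ a * cnj (sgn y) ^ b)))"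
      by (simp only: norm_mult norm_cis mult_1 sgn_mult power_mult_distrib complex_cnj_mult)
         (simp only: mult_ac)
  qed measurable
  also have "\<dots> = (cis \<theta> ^ a * cnj (cis \<theta>) ^ b) * I"
    by (simp add: I_def)
  also have "cis \<theta> ^ a * cnj (cis \<theta>) ^ b = cis ((real a - real b) * \<theta>)"
    unfolding cis_cnj Complex.DeMoivre cis_mult by (simp add: algebra_simps)
  finally have eq: "I = cis ((real a - real b) * \<theta>) * I" .
  have "(cis ((real a - real b) * \<theta>) - 1) * I = cis ((real a - real b) * \<theta>) * I - I"
    by (rule left_diff_distrib[of _ 1 I, unfolded mult_1])
  also have "\<dots> = 0"
    using eq unfolding right_minus_eq by (rule sym)
  finally have "(cis ((real a - real b) * \<theta>) - 1) * I = 0" .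
  moreover have "cis ((real a - real b) * \<theta>) \<noteq> 1"
  proof
    assume "cis ((real a - real b) * \<theta>) = 1"
    then have "sin ((real a - real b) * \<theta>) = 0"
      by (simp add: complex_eq_iff)
    moreover have "\<bar>(real a - real b) * \<theta>\<bar> < pi"
    proof -
      have "\<bar>(real a - real b) * \<theta>\<bar> = d * \<theta>"
        using \<theta> by (simp add: abs_mult d_def)
      also have "\<dots> < (d + 1) * \<theta>"
        using \<theta> by (intro mult_strict_right_mono) auto
      also have "\<dots> = pi" using d by (simp add: \<theta>_def)
      finally show ?thesis .
    qed
    ultimately have "(real a - real b) * \<theta> = 0"
      by (subst (asm) abs_less_iff) (rule sin_eq_0_pi; linarith)
    moreover have "real a - real b \<noteq> 0" "\<theta> \<noteq> 0"
      using False \<theta>(1) by simp_all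
    ultimately show False
      using mult_eq_0_iff by blast
  qed
  ultimately have "I = 0"
    by (metis mult_eq_0_iff right_minus_eq)
  then show ?thesis unfolding I_def using False by (simp only: if_False)
qed

section \<open>Bessel functions\<close>

text \<open>The Bessel-Clifford function at -y. It strips J_n of the factor (x/2)^n and leaves an
  ordinary power series in (x/2)^2, to which termwise differentiation applies.\<close>

definition clifford :: "nat \<Rightarrow> real \<Rightarrow> real" where
  "clifford n y = (\<Sum>k. (-1) ^ k / (fact k * fact (k + n)) * y ^ k)"

lemma clifford_sums: "(\<lambda>k. (-1) ^ k / (fact k * fact (k + n)) * y ^ k) sums clifford n y"
  and abs_clifford_le: "\<bar>clifford n y\<bar> \<le> exp \<bar>y\<bar>"
proof -
  have le: "norm ((-1) ^ k / (fact k * fact (k + n)) * y ^ k) \<le> \<bar>y\<bar> ^ k / fact k" for k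
  proof -
    have "norm ((-1) ^ k / (fact k * fact (k + n)) * y ^ k) = (\<bar>y\<bar> ^ k / fact k) / fact (k + n)"
      by (simp add: abs_mult power_abs)
    also have "\<dots> \<le> (\<bar>y\<bar> ^ k / fact k) / 1"
      by (intro divide_left_mono) (auto simp: fact_ge_1)
    finally show ?thesis by simp
  qed
  have exp: "(\<lambda>k. \<bar>y\<bar> ^ k / fact k) sums exp \<bar>y\<bar>"
    using exp_converges[of "\<bar>y\<bar>"] by (simp add: divide_inverse mult.commute)
  have sm: "summable (\<lambda>k. norm ((-1) ^ k / (fact k * fact (k + n)) * y ^ k))"
    by (rule summable_comparison_test'[OF sums_summable[OF exp], of 0]) (use le in \<open>simp only: real_norm_def abs_idempotent\<close>)
  then show "(\<lambda>k. (-1) ^ k / (fact k * fact (k + n)) * y ^ k) sums clifford n y"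
    unfolding clifford_def by (rule summable_sums[OF summable_norm_cancel])
  have "\<bar>clifford n y\<bar> \<le> (\<Sum>k. norm ((-1) ^ k / (fact k * fact (k + n)) * y ^ k))"
    using summable_norm[OF sm] unfolding clifford_def by simp
  also have "\<dots> \<le> (\<Sum>k. \<bar>y\<bar> ^ k / fact k)"
    by (rule suminf_le[OF le sm sums_summable[OF exp]])
  also have "\<dots> = exp \<bar>y\<bar>" using exp by (simp add: sums_iff)
  finally show "\<bar>clifford n y\<bar> \<le> exp \<bar>y\<bar>" .
qed

text \<open>Differentiating the series cancels one factor of the first factorial and leaves (k + 1 +
  n)!, which is the second factorial of the next index; the sign comes from the shift of k.\<close>

lemma has_field_derivative_clifford [derivative_intros]:
  "(clifford n has_field_derivative - clifford (Suc n) y) (at y)"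
proof -
  let ?c = "\<lambda>n k. (-1) ^ k / (fact k * fact (k + n)) :: real"
  have "diffs (?c n) k = - ?c (Suc n) k" for k
    unfolding diffs_def by (simp add: divide_simps add_ac del: of_nat_Suc)
  then have "(\<Sum>k. diffs (?c n) k * y ^ k) = - clifford (Suc n) y"
    using sums_minus[OF clifford_sums[of "Suc n" y]] by (simp add: sums_iff)
  then show ?thesis
    using termdiffs_strong_converges_everywhere[of "?c n" y] clifford_sums[of n]
    by (simp add: sums_iff clifford_def[abs_def])
qed

lemma clifford_recurrence:
  "clifford n y = real (n + 1) * clifford (n + 1) y - y * clifford (n + 2) y"
proof -
  let ?c = "\<lambda>n k. (-1) ^ k / (fact k * fact (k + n)) :: real"
  \<comment> \<open>The termwise difference starts at zero, and its term of index k + 1 is y times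
    the k-th term for n + 2; the recurrence is this shift by one.\<close>
  define d where "d k = real (n + 1) * (?c (n + 1) k * y ^ k) - ?c n k * y ^ k" for k
  have "d (Suc k) = y * (?c (n + 2) k * y ^ k)" for k
  proof -
    have *: "real (n + 1) * ?c (n + 1) (Suc k) - ?c n (Suc k) = ?c (n + 2) k"
    proof -
      have "(fact (Suc k + (n + 1)) :: real) = real (k + n + 2) * fact (k + n + 1)"
        "(fact (Suc k + n) :: real) = fact (k + n + 1)" 
        "(fact (k + (n + 2)) :: real) = real (k + n + 2) * fact (k + n + 1)" 
        "(fact (Suc k) :: real) = real (k + 1) * fact k"
        by (simp_all add: algebra_simps)
      moreover have "(fact (k + n + 1) :: real) > 0" "(fact k :: real) > 0" by simp_all
      ultimately show ?thesis
        by (simp only:) (simp add: divide_simps, simp add: algebra_simps)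
    qed
    have "d (Suc k) = (real (n + 1) * ?c (n + 1) (Suc k) - ?c n (Suc k)) * y ^ Suc k"
      unfolding d_def by (simp only: left_diff_distrib mult.assoc)
    then show ?thesis unfolding * by simp
  qed
  then have "(\<lambda>k. d (Suc k)) sums (y * clifford (n + 2) y)"
    using sums_mult[OF clifford_sums[of "n + 2" y], of y] by simp
  moreover have "d 0 = 0"
    by (simp add: d_def)
  ultimately have "d sums (y * clifford (n + 2) y)"
    by (simp add: sums_Suc_iff)
  moreover have "d sums (real (n + 1) * clifford (n + 1) y - clifford n y)"
    unfolding d_def by (intro sums_diff sums_mult clifford_sums)
  ultimately show ?thesis
    using sums_unique2 by fastforce
qed

lemma bessel_J_sums:
  "(\<lambda>k. (-1) ^ k / (fact k * fact (k + n)) * (x / 2) ^ (2 * k + n)) sums bessel_J n x"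
  and bessel_J_eq: "bessel_J n x = (x / 2) ^ n * clifford n ((x / 2) ^ 2)"
proof -
  have "(\<lambda>k. (x / 2) ^ n * ((-1) ^ k / (fact k * fact (k + n)) * ((x / 2) ^ 2) ^ k)) sums
      ((x / 2) ^ n * clifford n ((x / 2) ^ 2))"
    by (intro sums_mult clifford_sums)
  also have "(\<lambda>k. (x / 2) ^ n * ((-1) ^ k / (fact k * fact (k + n)) * ((x / 2) ^ 2) ^ k)) =
      (\<lambda>k. (-1) ^ k / (fact k * fact (k + n)) * (x / 2) ^ (2 * k + n))"
    by (simp only: power_add power_mult) (simp only: mult_ac)
  finally show "(\<lambda>k. (-1) ^ k / (fact k * fact (k + n)) * (x / 2) ^ (2 * k + n)) sums bessel_J n x"
    "bessel_J n x = (x / 2) ^ n * clifford n ((x / 2) ^ 2)"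
    unfolding bessel_J_def by (simp_all only: sums_iff)
qed

lemma continuous_on_bessel_J [continuous_intros]:
  assumes "continuous_on A f"
  shows "continuous_on A (\<lambda>x. bessel_J n (f x))"
proof -
  have "continuous_on UNIV (clifford n)"
    by (rule DERIV_continuous_on[OF has_field_derivative_at_within[OF has_field_derivative_clifford]])
  then have "continuous_on UNIV (\<lambda>x. clifford n ((x / 2) ^ 2))"
    by (rule continuous_on_compose2) (auto intro!: continuous_intros)
  then have "continuous_on UNIV (bessel_J n)"
    unfolding bessel_J_eq[abs_def] by (intro continuous_on_mult continuous_intros) auto
  from continuous_on_compose2[OF this assms] show ?thesis by auto
qed

lemma bessel_J_measurable [measurable]: "bessel_J n \<in> borel_measurable borel"
  by (intro borel_measurable_continuous_onI continuous_intros)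

lemma bessel_J_recurrence:
  assumes "x \<noteq> 0"
  shows "bessel_J (n + 2) x = 2 * real (n + 1) / x * bessel_J (n + 1) x - bessel_J n x"
proof -
  define h where "h = x / 2"
  have h: "h \<noteq> 0" "x = 2 * h" using assms by (simp_all add: h_def)
  have "2 * real (n + 1) / x * (h ^ (n + 1) * clifford (n + 1) (h ^ 2)) =
      h ^ n * (real (n + 1) * clifford (n + 1) (h ^ 2))"
    using h by simp
  then show ?thesis
    unfolding bessel_J_eq h_def[symmetric] clifford_recurrence[of n "h ^ 2"]
    by (simp only:) (simp add: algebra_simps power2_eq_square)
qed

section \<open>Decay of Bessel functions at infinity\<close>

lemma DERIV_clifford_square:
  "((\<lambda>x. clifford n ((x / 2) ^ 2)) has_real_derivative - (x / 2 * clifford (Suc n) ((x / 2) ^ 2))) (at x)"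
proof -
  have "((\<lambda>x. (x / 2) ^ 2) has_real_derivative x / 2) (at x)"
    by (auto intro!: derivative_eq_intros)
  from DERIV_chain2[OF has_field_derivative_clifford[of n "(x / 2) ^ 2"] this]
  show ?thesis by (simp only: mult_minus_left mult.commute[of "x / 2"])
qed

lemma DERIV_bessel_J_0: "(bessel_J 0 has_real_derivative - bessel_J 1 x) (at x)"
  using DERIV_clifford_square[of 0 x] unfolding bessel_J_eq[abs_def] by simp

lemma DERIV_bessel_J_1:
  assumes "x \<noteq> 0"
  shows "(bessel_J 1 has_real_derivative bessel_J 0 x - bessel_J 1 x / x) (at x)"
proof -
  define h where "h = x / 2"
  have h: "h \<noteq> 0" "x = 2 * h" using assms by (simp_all add: h_def)
  have "((\<lambda>x. x / 2 * clifford 1 ((x / 2) ^ 2)) has_real_derivative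
     1 / 2 * clifford 1 (h ^ 2) + - (h * clifford (Suc 1) (h ^ 2)) * h) (at x)"
    unfolding h_def by (rule DERIV_mult[OF _ DERIV_clifford_square]) (auto intro!: derivative_eq_intros)
  also have "1 / 2 * clifford 1 (h ^ 2) + - (h * clifford (Suc 1) (h ^ 2)) * h =
      clifford 0 (h ^ 2) - h * clifford 1 (h ^ 2) / x"
    using clifford_recurrence[of 0 "h ^ 2"] h by (simp add: numeral_2_eq_2 power2_eq_square)
  finally show ?thesis
    unfolding bessel_J_eq[abs_def] h_def by simp
qed

text \<open>
  The energy \<open>u'\<^sup>2 + (1 + 1 / (4 x\<^sup>2)) u\<^sup>2\<close> of \<open>u = \<surd>x J\<^sub>0\<close>, which solves
  \<open>u'' + (1 + 1 / (4 x\<^sup>2)) u = 0\<close>, is decreasing.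
\<close>

lemma bessel_J_energy_decreasing:
  assumes "0 < a" "a \<le> b"
  defines "E \<equiv> \<lambda>x. x * (bessel_J 0 x ^ 2 + bessel_J 1 x ^ 2) - bessel_J 0 x * bessel_J 1 x
     + bessel_J 0 x ^ 2 / (2 * x)"
  shows "E b \<le> E a"
proof (rule DERIV_nonpos_imp_nonincreasing[OF assms(2)])
  fix x assume "a \<le> x" "x \<le> b"
  then have x: "x > 0" using assms by simp
  \<comment> \<open>With u = \<surd>x J_0, expanding u'^2 + (1 + 1/(4x^2)) u^2 by J_0' = -J_1 gives
    \<open>E\<close>. By the differential equation of u only the derivative of the coefficient
    survives: -1/(2x^3) times u^2 = x J_0^2.\<close>
  have "(E has_real_derivative - (bessel_J 0 x ^ 2 / (2 * x ^ 2))) (at x)"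
    unfolding E_def using x
    by (auto intro!: derivative_eq_intros DERIV_bessel_J_0 DERIV_bessel_J_1[unfolded One_nat_def])
       (simp add: field_simps power2_eq_square)
  then show "\<exists>y. (E has_real_derivative y) (at x) \<and> y \<le> 0"
    by (intro exI[of _ "- (bessel_J 0 x ^ 2 / (2 * x ^ 2))"]) auto
qed

text \<open>Let S = J_0^2 + J_1^2. The cross term of the energy costs at most S/2 \<le> x S/2 for x
  \<ge> 1, hence x S/2 \<le> E(x) \<le> E(1), and C = 2 E(1) works.\<close>

lemma bessel_J_01_bound: "\<exists>C\<ge>0. \<forall>x\<ge>1. bessel_J 0 x ^ 2 + bessel_J 1 x ^ 2 \<le> C / x"
proof -
  define E where "E x = x * (bessel_J 0 x ^ 2 + bessel_J 1 x ^ 2) - bessel_J 0 x * bessel_J 1 x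
     + bessel_J 0 x ^ 2 / (2 * x)" for x
  have bound: "(bessel_J 0 x ^ 2 + bessel_J 1 x ^ 2) * x \<le> 2 * E 1" if "x \<ge> 1" for x
  proof -
    let ?S = "bessel_J 0 x ^ 2 + bessel_J 1 x ^ 2"
    have "E x \<le> E 1"
      using bessel_J_energy_decreasing[of 1 x] that by (simp add: E_def)
    moreover have "E x \<ge> x * ?S - bessel_J 0 x * bessel_J 1 x"
      using that by (simp add: E_def)
    moreover have "2 * (bessel_J 0 x * bessel_J 1 x) \<le> ?S"
      using sum_squares_bound[of "bessel_J 0 x" "bessel_J 1 x"] by simp
    moreover have "?S \<le> x * ?S"
      using that mult_right_mono[of 1 x ?S] by simp
    ultimately show ?thesis by (simp add: mult.commute)
  qed
  have "0 \<le> 2 * E 1" using bound[of 1] by (smt (verit) sum_power2_ge_zero mult_1_right order_refl)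
  then show ?thesis using bound by (intro exI[of _ "2 * E 1"]) (auto simp: field_simps)
qed

text \<open>The energy bound supplies the two base cases. In the three-term recurrence the
  coefficient 2(n+1)/x is at most 2(n+1) on x \<ge> 1, so the rate x^(-1/2) is inherited and only
  the constant grows.\<close>

lemma bessel_J_bound_at_infinity: "\<exists>C. \<forall>x\<ge>1. \<bar>bessel_J n x\<bar> \<le> C * x powr (- 1 / 2)"
proof (induction n rule: induct_nat_012)
  case 0
  from bessel_J_01_bound obtain C where C: "C \<ge> 0" "\<And>x. x \<ge> 1 \<Longrightarrow> bessel_J 0 x ^ 2 + bessel_J 1 x ^ 2 \<le> C / x"
    by blast
  show ?case
  proof (intro exI[of _ "sqrt C"] allI impI)
    fix x :: real assume x: "x \<ge> 1"
    then have "bessel_J 0 x ^ 2 \<le> C / x" using C(2)[of x] by (smt (verit) zero_le_power2)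
    then have "\<bar>bessel_J 0 x\<bar> \<le> sqrt (C / x)" using real_le_rsqrt real_sqrt_le_mono by fastforce
    then show "\<bar>bessel_J 0 x\<bar> \<le> sqrt C * x powr (- 1 / 2)"
      using x by (simp add: real_sqrt_divide powr_minus_divide powr_half_sqrt)
  qed
next
  case 1
  from bessel_J_01_bound obtain C where C: "C \<ge> 0" "\<And>x. x \<ge> 1 \<Longrightarrow> bessel_J 0 x ^ 2 + bessel_J 1 x ^ 2 \<le> C / x"
    by blast
  show ?case
  proof (intro exI[of _ "sqrt C"] allI impI)
    fix x :: real assume x: "x \<ge> 1"
    then have "bessel_J (Suc 0) x ^ 2 \<le> C / x" using C(2)[of x] by simp (smt (verit) zero_le_power2)
    then have "\<bar>bessel_J (Suc 0) x\<bar> \<le> sqrt (C / x)" using real_le_rsqrt real_sqrt_le_mono by fastforce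
    then show "\<bar>bessel_J (Suc 0) x\<bar> \<le> sqrt C * x powr (- 1 / 2)"
      using x by (simp add: real_sqrt_divide powr_minus_divide powr_half_sqrt)
  qed
next
  case (ge2 n)
  then obtain C D where C: "\<And>x. x \<ge> 1 \<Longrightarrow> \<bar>bessel_J n x\<bar> \<le> C * x powr (- 1 / 2)"
    and D: "\<And>x. x \<ge> 1 \<Longrightarrow> \<bar>bessel_J (Suc n) x\<bar> \<le> D * x powr (- 1 / 2)"
    by blast
  show ?case
  proof (intro exI[of _ "2 * real (n + 1) * D + C"] allI impI)
    fix x :: real assume x: "x \<ge> 1"
    have "bessel_J (Suc (Suc n)) x = 2 * real (n + 1) / x * bessel_J (Suc n) x - bessel_J n x"
      using bessel_J_recurrence[of x n] x by simp
    then have "\<bar>bessel_J (Suc (Suc n)) x\<bar> \<le> \<bar>2 * real (n + 1) / x * bessel_J (Suc n) x\<bar> + \<bar>bessel_J n x\<bar>"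
      by (simp only:) (rule abs_triangle_ineq4)
    also have "\<bar>2 * real (n + 1) / x * bessel_J (Suc n) x\<bar> = 2 * real (n + 1) / x * \<bar>bessel_J (Suc n) x\<bar>"
      using x by (simp add: abs_mult)
    also have "\<dots> \<le> 2 * real (n + 1) / 1 * \<bar>bessel_J (Suc n) x\<bar>"
      using x by (intro mult_right_mono divide_left_mono) auto
    also have "\<dots> \<le> 2 * real (n + 1) / 1 * (D * x powr (- 1 / 2))"
      using D[OF x] by (intro mult_left_mono) auto
    finally show "\<bar>bessel_J (Suc (Suc n)) x\<bar> \<le> (2 * real (n + 1) * D + C) * x powr (- 1 / 2)"
      using C[OF x] by (simp add: algebra_simps)
  qed
qed

lemma bessel_J_bound_near_0:
  assumes "0 \<le> x" "x \<le> 1"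
  shows "\<bar>bessel_J n x\<bar> \<le> exp 1"
proof -
  have "\<bar>clifford n ((x / 2) ^ 2)\<bar> \<le> exp 1"
  proof -
    have "(x / 2) ^ 2 \<le> 1" using assms by (intro power_le_one) auto
    then show ?thesis
      using abs_clifford_le[of n "(x / 2) ^ 2"] by (intro order_trans[OF abs_clifford_le]) simp
  qed
  moreover have "\<bar>x / 2\<bar> ^ n \<le> 1" using assms by (intro power_le_one) auto
  ultimately show ?thesis
    unfolding bessel_J_eq abs_mult power_abs
    using mult_mono[of "\<bar>x / 2\<bar> ^ n" 1 "\<bar>clifford n ((x / 2) ^ 2)\<bar>" "exp 1"] by simp
qed

section \<open>The Hankel transform of a power\<close>

lemma integrable_powr_at_0:
  assumes "a > -1" "c \<ge> (0::real)"
  shows "integrable lborel (\<lambda>r. indicator {0..c} r * r powr a)"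
proof -
  have "set_integrable lebesgue {0..c} (\<lambda>r. r powr a)"
    using has_integral_powr_from_0[OF assms] by (intro nonnegative_absolutely_integrable_1) auto
  then show ?thesis
    unfolding set_integrable_def by (subst (asm) integrable_completion) auto
qed

lemma integrable_powr_at_infinity:
  assumes "e < -1" "c > (0::real)"
  shows "integrable lborel (\<lambda>r. indicator {c..} r * r powr e)"
proof -
  have "set_integrable lebesgue {c..} (\<lambda>r. r powr e)"
    using has_integral_powr_to_inf[OF assms] by (intro nonnegative_absolutely_integrable_1) auto
  then show ?thesis
    unfolding set_integrable_def by (subst (asm) integrable_completion) auto
qed

text \<open>Near 0 the Bessel factor is merely bounded, so r^(1-\<sigma>) must be integrable there:
  \<sigma> < 2. At infinity it contributes r^(-1/2), so r^(1/2-\<sigma>) must be integrable: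
  \<sigma> > 3/2. The cut lies at r = 1/\<rho>, where the argument of J_n reaches 1.\<close>

lemma integrable_powr_bessel_J:
  assumes \<sigma>: "3/2 < \<sigma>" "\<sigma> < 2" and \<rho>: "\<rho> > 0"
  shows "integrable lborel (\<lambda>r. indicator {0<..} r * (r powr (1 - \<sigma>) * bessel_J n (\<rho> * r)))"
proof -
  obtain C where C: "\<And>x. x \<ge> 1 \<Longrightarrow> \<bar>bessel_J n x\<bar> \<le> C * x powr (- 1 / 2)"
    using bessel_J_bound_at_infinity by blast
  define D where "D = C * \<rho> powr (- 1 / 2)"
  have "integrable lborel (\<lambda>r. exp 1 * (indicator {0..1 / \<rho>} r * r powr (1 - \<sigma>)) +
      D * (indicator {1 / \<rho>..} r * r powr (1 / 2 - \<sigma>)))"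
    using \<sigma> \<rho> by (intro Bochner_Integration.integrable_add integrable_mult_right
        integrable_powr_at_0 integrable_powr_at_infinity) auto
  then show ?thesis
  proof (rule Bochner_Integration.integrable_bound)
    show "AE r in lborel. norm (indicator {0<..} r * (r powr (1 - \<sigma>) * bessel_J n (\<rho> * r))) \<le>
        norm (exp 1 * (indicator {0..1 / \<rho>} r * r powr (1 - \<sigma>)) +
              D * (indicator {1 / \<rho>..} r * r powr (1 / 2 - \<sigma>)))"
    proof (rule AE_I2)
      fix r :: real
      \<comment> \<open>The bound at x = 1 shows C \<ge> 0. With D nonnegative neither piece of the
        majorant can spoil the other.\<close>
      have D: "D \<ge> 0" using C[of 1] \<rho> by (simp add: D_def) 
      have small: "\<bar>bessel_J n (\<rho> * r)\<bar> \<le> exp 1" if "0 < r" "r \<le> 1 / \<rho>"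
        using that \<rho> by (intro bessel_J_bound_near_0) (auto simp: field_simps)
      have large: "r powr (1 - \<sigma>) * \<bar>bessel_J n (\<rho> * r)\<bar> \<le> D * r powr (1 / 2 - \<sigma>)" if "r \<ge> 1 / \<rho>"
      proof -
        have r: "r > 0" "\<rho> * r \<ge> 1" using that \<rho> by (auto simp: field_simps intro: less_le_trans[of 0 "1 / \<rho>"])
        have "r powr (1 - \<sigma>) * \<bar>bessel_J n (\<rho> * r)\<bar> \<le> r powr (1 - \<sigma>) * (C * (\<rho> * r) powr (- 1 / 2))"
          using C[OF r(2)] by (intro mult_left_mono) auto
        also have "(\<rho> * r) powr (- 1 / 2) = \<rho> powr (- 1 / 2) * r powr (- 1 / 2)"
          using r \<rho> by (simp add: powr_mult)
        also have "r powr (1 - \<sigma>) * (C * (\<rho> powr (- 1 / 2) * r powr (- 1 / 2))) =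
            D * (r powr (1 - \<sigma>) * r powr (- 1 / 2))"
          by (simp add: D_def)
        also have "r powr (1 - \<sigma>) * r powr (- 1 / 2) = r powr (1 / 2 - \<sigma>)"
          by (simp add: powr_add[symmetric])
        finally show ?thesis .
      qed
      consider "r \<le> 0" | "0 < r" "r \<le> 1 / \<rho>" | "0 < r" "r > 1 / \<rho>" by linarith
      then show "norm (indicator {0<..} r * (r powr (1 - \<sigma>) * bessel_J n (\<rho> * r))) \<le>
        norm (exp 1 * (indicator {0..1 / \<rho>} r * r powr (1 - \<sigma>)) +
              D * (indicator {1 / \<rho>..} r * r powr (1 / 2 - \<sigma>)))"
      proof cases
        case 2
        have "norm (indicator {0<..} r * (r powr (1 - \<sigma>) * bessel_J n (\<rho> * r))) \<le> exp 1 * r powr (1 - \<sigma>)"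
          using 2 small mult_right_mono[OF small, of "r powr (1 - \<sigma>)"] by (simp add: abs_mult mult.commute)
        also have "\<dots> \<le> norm (exp 1 * (indicator {0..1 / \<rho>} r * r powr (1 - \<sigma>)) +
              D * (indicator {1 / \<rho>..} r * r powr (1 / 2 - \<sigma>)))"
          using 2 D by (simp add: indicator_def)
        finally show ?thesis .
      next
        case 3
        then show ?thesis using large D by (simp add: abs_mult indicator_def)
      qed simp
    qed
  qed measurable
qed

text \<open>Each Gaussian moment contributes (k+n)!, which cancels the same factorial in the Bessel
  series and leaves the exponential series in -\<rho>^2/(4p). The integrals of the absolute values
  form the series of exp(\<rho>^2/(4p)), which justifies the interchange.\<close>

lemma has_bochner_integral_Weber:
  assumes p: "p > (0::real)"
  shows "has_bochner_integral lborel
           (\<lambda>r. indicator {0<..} r * (r ^ (n + 1) * bessel_J n (\<rho> * r) * exp (- (p * r ^ 2))))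
           (\<rho> ^ n / (2 * p) ^ (n + 1) * exp (- (\<rho>\<^sup>2 / (4 * p))))"
proof -
  define a where "a k = (-1) ^ k / (fact k * fact (k + n)) * (\<rho> / 2) ^ (2 * k + n)" for k
  define f where "f k r = a k * (indicator {0<..} r * (r ^ (2 * (k + n) + 1) * exp (- (p * r ^ 2))))" for k r
  define b where "b = (\<rho> / 2) ^ n / (2 * p ^ (n + 1))"
  define q where "q = \<rho>\<^sup>2 / (4 * p)"
  have int: "has_bochner_integral lborel (f k) (a k * (fact (k + n) / (2 * p ^ (k + n + 1))))" for k
    unfolding f_def by (intro has_bochner_integral_mult_right has_bochner_integral_gaussian_moment_halfline p)
  have coeff: "a k * (fact (k + n) / (2 * p ^ (k + n + 1))) = b * ((- q) ^ k / fact k)" for k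
  proof -
    have 1: "(\<rho> / 2) ^ (2 * k) = (\<rho>\<^sup>2 / 4) ^ k"
      by (simp add: power_mult power_divide)
    have 2: "(- q) ^ k = (-1) ^ k * ((\<rho>\<^sup>2 / 4) ^ k / p ^ k)"
      by (subst power_minus) (simp add: q_def power_divide power_mult_distrib)
    \<comment> \<open>The cancellation is proved over free variables, so that factorials and powers
      enter it as atoms.\<close>
    have 3: "e / (fk * F) * (X * h) * (F / (2 * (pk * pn * p'))) = h / (2 * (pn * p')) * (e * (X / pk) / fk)"
      if "F \<noteq> 0" "fk \<noteq> 0" "pk \<noteq> 0" "pn \<noteq> 0" "p' \<noteq> 0" for e fk F X h pk pn p' :: real
      using that by (simp add: divide_simps)
    show ?thesis
      unfolding a_def b_def power_add power_one_right 1 2 by (rule 3) (use p in auto)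
  qed
  have sums: "(\<lambda>k. f k r) sums (indicator {0<..} r * (r ^ (n + 1) * bessel_J n (\<rho> * r) * exp (- (p * r ^ 2))))" for r
  proof -
    have "(\<lambda>k. indicator {0<..} r * (r ^ (n + 1) * ((-1) ^ k / (fact k * fact (k + n)) * (\<rho> * r / 2) ^ (2 * k + n)) * 
        exp (- (p * r ^ 2)))) sums (indicator {0<..} r * (r ^ (n + 1) * bessel_J n (\<rho> * r) * exp (- (p * r ^ 2))))"
      by (intro sums_mult sums_mult2 bessel_J_sums)
    moreover have "indicator {0<..} r * (r ^ (n + 1) * ((-1) ^ k / (fact k * fact (k + n)) * (\<rho> * r / 2) ^ (2 * k + n)) * 
        exp (- (p * r ^ 2))) = f k r" for k
    proof -
      have 1: "(\<rho> * r / 2) ^ (2 * k + n) = (\<rho> / 2) ^ (2 * k + n) * r ^ (2 * k + n)"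
        by (simp flip: power_mult_distrib)
      have 2: "r ^ (2 * (k + n) + 1) = r ^ (2 * k + n) * r ^ (n + 1)"
        by (simp flip: power_add) (simp add: algebra_simps)
      show ?thesis unfolding f_def a_def 1 2 by (simp only: mult_ac)
    qed
    ultimately show ?thesis by simp
  qed
  have norm_f: "(LINT r|lborel. norm (f k r)) = b' * (q ^ k / fact k)" if "b' = \<bar>b\<bar>" for k b'
  proof -
    have 1: "has_bochner_integral lborel (\<lambda>r. \<bar>a k\<bar> * (indicator {0<..} r * (r ^ (2 * (k + n) + 1) * exp (- (p * r ^ 2)))))
       (\<bar>a k\<bar> * (fact (k + n) / (2 * p ^ (k + n + 1))))"
      by (intro has_bochner_integral_mult_right has_bochner_integral_gaussian_moment_halfline p)
    have 2: "norm (f k r) = \<bar>a k\<bar> * (indicator {0<..} r * (r ^ (2 * (k + n) + 1) * exp (- (p * r ^ 2))))" for r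
      by (simp add: f_def abs_mult indicator_def)
    have 3: "\<bar>a k\<bar> * (fact (k + n) / (2 * p ^ (k + n + 1))) = \<bar>b * ((- q) ^ k / fact k)\<bar>"
      unfolding coeff[symmetric] using p by (simp add: abs_mult)
    have 4: "\<bar>b * ((- q) ^ k / fact k)\<bar> = b' * (q ^ k / fact k)"
      using p that by (simp add: abs_mult power_abs q_def)
    show ?thesis
      unfolding 2 has_bochner_integral_integral_eq[OF 1] 3 4 ..
  qed
  have expq: "summable (\<lambda>k. q ^ k / fact k)"
    using exp_converges[of q] by (auto simp: sums_iff divide_inverse mult.commute)
  have summable_norm: "summable (\<lambda>k. norm (f k r))" for r
  proof -
    have "summable (\<lambda>k. \<bar>indicator {0<..} r * (r ^ (2 * n + 1) * exp (- (p * r ^ 2))) * (\<rho> / 2) ^ n\<bar> * ((\<rho> ^ 2 / 4 * r ^ 2) ^ k / fact k))"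
      by (rule summable_mult)
         (use summable_exp[of "\<rho> ^ 2 / 4 * r ^ 2"] in \<open>simp only: divide_inverse mult.commute\<close>)
    then show ?thesis
    \<comment> \<open>The majorant drops the factor 1/(k+n)!, which is at most 1; what is left is an
      exponential series in \<rho>^2 r^2/4.\<close>
    proof (rule summable_comparison_test'[of _ 0])
      fix k
      have 1: "(\<rho> / 2) ^ (2 * k + n) = (\<rho>\<^sup>2 / 4) ^ k * (\<rho> / 2) ^ n"
        unfolding power_add power_mult by (simp add: power_divide)
      have 2: "r ^ (2 * (k + n) + 1) = (r\<^sup>2) ^ k * r ^ (2 * n + 1)"
        by (simp add: algebra_simps flip: power_add power_mult)
      have "f k r = indicator {0<..} r * (r ^ (2 * n + 1) * exp (- (p * r ^ 2))) * (\<rho> / 2) ^ n *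
          ((-1) ^ k * ((\<rho> ^ 2 / 4 * r ^ 2) ^ k / fact k / fact (k + n)))"
        unfolding f_def a_def 1 2
        unfolding power_mult_distrib divide_inverse inverse_mult_distrib by (simp only: mult_ac)
      then have "norm (norm (f k r)) = \<bar>indicator {0<..} r * (r ^ (2 * n + 1) * exp (- (p * r ^ 2))) * (\<rho> / 2) ^ n\<bar> *
          ((\<rho> ^ 2 / 4 * r ^ 2) ^ k / fact k) / fact (k + n)"
        by (simp only: real_norm_def abs_idempotent abs_mult power_abs abs_neg_one power_one mult_1) simp
      also have "\<dots> \<le> \<bar>indicator {0<..} r * (r ^ (2 * n + 1) * exp (- (p * r ^ 2))) * (\<rho> / 2) ^ n\<bar> *
          ((\<rho> ^ 2 / 4 * r ^ 2) ^ k / fact k) / 1"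
        by (intro divide_left_mono mult_nonneg_nonneg divide_nonneg_nonneg zero_le_power[of "\<rho>\<^sup>2 / 4 * r\<^sup>2"])
           (auto simp: fact_ge_1)
      finally show "norm (norm (f k r)) \<le> \<bar>indicator {0<..} r * (r ^ (2 * n + 1) * exp (- (p * r ^ 2))) * (\<rho> / 2) ^ n\<bar> *
          ((\<rho> ^ 2 / 4 * r ^ 2) ^ k / fact k)" by simp
    qed
  qed
  have integrable: "integrable lborel (f k)" for k
    using int by (simp add: has_bochner_integral_iff)
  have summable_int: "summable (\<lambda>k. LINT r|lborel. norm (f k r))"
    unfolding norm_f[OF refl] by (intro summable_mult expq)
  have AE: "AE r in lborel. summable (\<lambda>k. norm (f k r))"
    using summable_norm by simp
  have "(\<lambda>k. integral\<^sup>L lborel (f k)) sums (LINT r|lborel. (\<Sum>k. f k r))"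
    by (rule sums_integral[OF integrable AE summable_int])
  moreover have "integral\<^sup>L lborel (f k) = b * ((- q) ^ k / fact k)" for k
    using int[of k] unfolding coeff by (simp add: has_bochner_integral_iff)
  moreover have "(\<lambda>k. b * ((- q) ^ k / fact k)) sums (b * exp (- q))"
    using exp_converges[of "- q"] by (intro sums_mult) (simp add: divide_inverse mult.commute)
  ultimately have "(LINT r|lborel. (\<Sum>k. f k r)) = b * exp (- q)"
    by (simp add: sums_iff)
  then have "has_bochner_integral lborel (\<lambda>r. \<Sum>k. f k r) (b * exp (- q))"
    using integrable_suminf[OF integrable AE summable_int] by (simp add: has_bochner_integral_iff)
  also have "(\<lambda>r. \<Sum>k. f k r) = (\<lambda>r. indicator {0<..} r * (r ^ (n + 1) * bessel_J n (\<rho> * r) * exp (- (p * r ^ 2))))"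
    using sums by (simp add: sums_iff)
  also have "b * exp (- q) = \<rho> ^ n / (2 * p) ^ (n + 1) * exp (- (\<rho>\<^sup>2 / (4 * p)))"
    using p by (simp add: b_def q_def power_mult_distrib power_divide)
  finally show ?thesis .
qed

lemma complex_of_real_powr: "t > 0 \<Longrightarrow> complex_of_real t powr z = exp (z * of_real (ln t))"
  by (simp add: powr_def Ln_of_real)

lemma Fubini_lborel:
  fixes f :: "'a::euclidean_space \<Rightarrow> 'b::euclidean_space \<Rightarrow> complex"
  assumes f: "case_prod f \<in> borel_measurable (lborel \<Otimes>\<^sub>M lborel)"
    and fin: "(\<integral>\<^sup>+x. (\<integral>\<^sup>+y. ennreal (norm (f x y)) \<partial>lborel) \<partial>lborel) < \<infinity>"
  shows "(LINT y|lborel. LINT x|lborel. f x y) = (LINT x|lborel. LINT y|lborel. f x y)"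
    and "integrable lborel (\<lambda>y. LINT x|lborel. f x y)"
    and "integrable lborel (\<lambda>x. LINT y|lborel. f x y)"
proof -
  have *: "integrable (lborel \<Otimes>\<^sub>M lborel) (case_prod f)"
  proof (rule integrableI_bounded)
    have "(\<integral>\<^sup>+p. ennreal (norm (case_prod f p)) \<partial>(lborel \<Otimes>\<^sub>M lborel)) =
        (\<integral>\<^sup>+x. (\<integral>\<^sup>+y. ennreal (norm (case_prod f (x, y))) \<partial>lborel) \<partial>lborel)"
      by (rule lborel.nn_integral_fst[symmetric])
         (rule measurable_compose[OF f, where g = "\<lambda>x. ennreal (norm x)"], measurable)
    then show "(\<integral>\<^sup>+p. ennreal (norm (case_prod f p)) \<partial>(lborel \<Otimes>\<^sub>M lborel)) < \<infinity>"
      using fin by simp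
  qed (fact f)
  from lborel_pair.Fubini_integral[OF this]
  show "(LINT y|lborel. LINT x|lborel. f x y) = (LINT x|lborel. LINT y|lborel. f x y)" .
  show "integrable lborel (\<lambda>y. LINT x|lborel. f x y)"
    using lborel_pair.integrable_snd[OF *] .
  show "integrable lborel (\<lambda>x. LINT y|lborel. f x y)"
    using lborel_pair.integrable_fst[OF *] .
qed

theorem has_hankel_integral_powr:
  assumes w: "3/2 < Re w" "Re w < 2" and \<rho>: "\<rho> > 0"
  shows "has_hankel_integral n (\<lambda>r. of_real r powr (- w)) \<rho>
           (2 powr (1 - w) * of_real \<rho> powr (w - 2) * Gamma ((of_nat n + 2 - w) / 2) * rGamma ((of_nat n + w) / 2))"
proof -
  \<comment> \<open>The choice of \<open>a\<close> makes r^(n+1) r^(-2a) equal to r^(1-w), so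
    subordination exposes the power r^(n+1) of Weber's integral. Then \<open>z\<close> is n + 1 - a:
    Weber's factor p^(-n-1) turns p^(a-1) into p^(-z-1). Both real parts are positive in the
    strip.\<close>
  define a where "a = (of_nat n + w) / 2"
  define z where "z = (of_nat n + 2 - w) / 2"
  have a: "Re a > 0" and z: "Re z > 0" using w by (simp_all add: a_def z_def)
  define M where "M r = indicator {0<..} r *\<^sub>R (of_real r powr (1 - w) * of_real (bessel_J n (\<rho> * r)))" for r
  define K where "K r p = indicator {0<..} r *\<^sub>R (indicator {0<..} p *\<^sub>R
     (of_real (r ^ (n + 1) * bessel_J n (\<rho> * r)) * (of_real p powr (a - 1) * of_real (exp (- (p * r ^ 2))))))"
    for r p :: real
  have K_meas: "case_prod K \<in> borel_measurable (lborel \<Otimes>\<^sub>M lborel)"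
    unfolding K_def case_prod_unfold by measurable
  have powr_r: "of_real (r ^ (n + 1)) * of_real (r ^ 2) powr (- a) = complex_of_real r powr (1 - w)" if "r > 0" for r :: real
  proof -
    have "complex_of_real (r ^ (n + 1)) = exp (of_real (real (n + 1) * ln r))"
      using that by (simp only: ln_realpow[symmetric] exp_of_real[symmetric]) (simp add: exp_of_real)
    moreover have "ln (r ^ 2) = 2 * ln r" using that by (simp add: ln_realpow)
    ultimately show ?thesis
      using that by (simp only: complex_of_real_powr zero_less_power exp_add[symmetric])
        (rule arg_cong[of _ _ exp], simp add: a_def algebra_simps)
  qed
  have inner_p: "(LINT p|lborel. K r p) = Gamma a * M r" for r
  proof (cases "r > 0")
    case True
    have "has_bochner_integral lborel (\<lambda>p. of_real (r ^ (n + 1) * bessel_J n (\<rho> * r)) * (indicator {0<..} p *\<^sub>R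
        (of_real p powr (a - 1) * of_real (exp (- (r ^ 2 * p))))))
        (of_real (r ^ (n + 1) * bessel_J n (\<rho> * r)) * (Gamma a * of_real (r ^ 2) powr (- a)))"
      using True by (intro has_bochner_integral_mult_right has_bochner_integral_Gamma_complex a) auto
    then have "(LINT p|lborel. K r p) = of_real (r ^ (n + 1) * bessel_J n (\<rho> * r)) * (Gamma a * of_real (r ^ 2) powr (- a))"
      using True by (simp add: K_def has_bochner_integral_iff mult.commute)
    also have "\<dots> = Gamma a * ((of_real (r ^ (n + 1)) * of_real (r ^ 2) powr (- a)) * of_real (bessel_J n (\<rho> * r)))"
      by (simp only: of_real_mult mult_ac)
    finally show ?thesis
      unfolding powr_r[OF True] using True by (simp add: M_def)
  qed (simp add: K_def M_def)
  have inner_r: "(LINT r|lborel. K r p) = of_real (\<rho> ^ n / 2 ^ (n + 1)) * (indicator {0<..} p *\<^sub>R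
      (of_real p powr (- z - 1) * of_real (exp (- (\<rho>\<^sup>2 / 4 / p)))))" for p
  proof (cases "p > 0")
    case True
    have "has_bochner_integral lborel (\<lambda>r. of_real p powr (a - 1) * of_real (indicator {0<..} r *
        (r ^ (n + 1) * bessel_J n (\<rho> * r) * exp (- (p * r ^ 2)))))
        (of_real p powr (a - 1) * of_real (\<rho> ^ n / (2 * p) ^ (n + 1) * exp (- (\<rho>\<^sup>2 / (4 * p)))))"
      using True by (intro has_bochner_integral_mult_right has_bochner_integral_of_real has_bochner_integral_Weber)
    moreover have "K r p = of_real p powr (a - 1) * of_real (indicator {0<..} r *
        (r ^ (n + 1) * bessel_J n (\<rho> * r) * exp (- (p * r ^ 2))))" for r
      using True by (simp add: K_def scaleR_conv_of_real mult_ac)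
    ultimately have "(LINT r|lborel. K r p) =
        of_real p powr (a - 1) * of_real (\<rho> ^ n / (2 * p) ^ (n + 1) * exp (- (\<rho>\<^sup>2 / (4 * p))))"
      by (simp only: has_bochner_integral_iff)
    also have "\<rho> ^ n / (2 * p) ^ (n + 1) * exp (- (\<rho>\<^sup>2 / (4 * p))) =
        \<rho> ^ n / 2 ^ (n + 1) * exp (- (\<rho>\<^sup>2 / 4 / p)) * (1 / p ^ (n + 1))"
      by (simp only: power_mult_distrib) (simp add: divide_simps)
    also have "of_real p powr (a - 1) * complex_of_real (\<rho> ^ n / 2 ^ (n + 1) * exp (- (\<rho>\<^sup>2 / 4 / p)) * (1 / p ^ (n + 1))) =
        of_real (\<rho> ^ n / 2 ^ (n + 1)) * ((of_real p powr (a - 1) * of_real (1 / p ^ (n + 1))) * of_real (exp (- (\<rho>\<^sup>2 / 4 / p))))"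
      by (simp only: of_real_mult mult_ac)
    also have "of_real p powr (a - 1) * complex_of_real (1 / p ^ (n + 1)) = of_real p powr (- z - 1)"
    proof -
      have "complex_of_real (1 / p ^ (n + 1)) = exp (of_real (- (real (n + 1) * ln p)))"
        using True by (simp only: ln_realpow[symmetric] exp_of_real[symmetric]) (simp add: exp_of_real exp_minus divide_inverse)
      then show ?thesis
        using True by (simp only: complex_of_real_powr exp_add[symmetric])
          (rule arg_cong[of _ _ exp], simp add: a_def z_def field_simps)
    qed
    finally show ?thesis using True by simp
  qed (simp add: K_def)
  have M_int: "integrable lborel (\<lambda>r. indicator {0<..} r * (r powr (1 - Re w) * bessel_J n (\<rho> * r)))"
    using w \<rho> by (intro integrable_powr_bessel_J)
  \<comment> \<open>Taking the p-integral of |K| first gives back \<Gamma>(Re a) r^(1 - Re w)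
    |J_n(\<rho> r)|, so Fubini's condition is the integrability of the original integrand.\<close>
  have "(\<integral>\<^sup>+r. (\<integral>\<^sup>+p. ennreal (norm (K r p)) \<partial>lborel) \<partial>lborel) =
      (\<integral>\<^sup>+r. ennreal (Gamma (Re a)) * ennreal (norm (indicator {0<..} r * (r powr (1 - Re w) * bessel_J n (\<rho> * r)))) \<partial>lborel)"
  proof (rule nn_integral_cong)
    fix r :: real
    show "(\<integral>\<^sup>+p. ennreal (norm (K r p)) \<partial>lborel) =
        ennreal (Gamma (Re a)) * ennreal (norm (indicator {0<..} r * (r powr (1 - Re w) * bessel_J n (\<rho> * r))))"
    proof (cases "r > 0")
      case True
      have "norm (K r p) = r ^ (n + 1) * \<bar>bessel_J n (\<rho> * r)\<bar> *
          (indicator {0<..} p * (p powr (Re a - 1) * exp (- (r\<^sup>2 * p))))" for p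
        using True by (simp add: K_def norm_mult norm_powr_real_powr indicator_def abs_mult mult.commute norm_power)
      then have "(\<integral>\<^sup>+p. ennreal (norm (K r p)) \<partial>lborel) =
          (\<integral>\<^sup>+p. ennreal (r ^ (n + 1) * \<bar>bessel_J n (\<rho> * r)\<bar>) *
             ennreal (indicator {0<..} p * (p powr (Re a - 1) * exp (- (r\<^sup>2 * p)))) \<partial>lborel)"
        using True by (intro nn_integral_cong) (simp add: ennreal_mult')
      also have "\<dots> = ennreal (r ^ (n + 1) * \<bar>bessel_J n (\<rho> * r)\<bar>) * ennreal (Gamma (Re a) * (r\<^sup>2) powr (- Re a))"
        using True a by (subst nn_integral_cmult) (auto simp: nn_integral_Gamma)
      also have "\<dots> = ennreal (Gamma (Re a) * ((r ^ (n + 1) * (r\<^sup>2) powr (- Re a)) * \<bar>bessel_J n (\<rho> * r)\<bar>))"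
        using True by (subst ennreal_mult'[symmetric]) (auto simp: mult_ac)
      also have "r ^ (n + 1) * (r\<^sup>2) powr (- Re a) = r powr (1 - Re w)"
      proof -
        have "r ^ (n + 1) = r powr (real (n + 1))" "r\<^sup>2 = r powr 2"
          using True by (simp_all only: powr_realpow powr_numeral)
        then show ?thesis
          by (simp only: powr_powr powr_add[symmetric]) (rule arg_cong[of _ _ "(powr) r"], simp add: a_def field_simps)
      qed
      finally show ?thesis
        using True Gamma_real_pos[OF a] by (simp add: abs_mult ennreal_mult)
    qed (simp add: K_def)
  qed
  also have "\<dots> = ennreal (Gamma (Re a)) * (\<integral>\<^sup>+r. ennreal (norm (indicator {0<..} r * (r powr (1 - Re w) * bessel_J n (\<rho> * r)))) \<partial>lborel)"
    by (rule nn_integral_cmult) measurable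
  also have "\<dots> < \<infinity>"
    using M_int by (simp add: integrable_iff_bounded ennreal_mult_less_top)
  finally have fin: "(\<integral>\<^sup>+r. (\<integral>\<^sup>+p. ennreal (norm (K r p)) \<partial>lborel) \<partial>lborel) < \<infinity>" .
  have Gz: "Gamma a \<noteq> 0" 
    using a by (auto simp: Gamma_eq_zero_iff elim!: nonpos_Ints_cases)
  have "integrable lborel (\<lambda>r. Gamma a * M r)"
    using Fubini_lborel(3)[OF K_meas fin] by (simp only: inner_p)
  then have "integrable lborel (\<lambda>r. inverse (Gamma a) * (Gamma a * M r))"
    by (rule integrable_mult_right)
  then have M_int': "integrable lborel M"
    using Gz by (simp add: mult.assoc[symmetric])
  have "Gamma a * (LINT r|lborel. M r) = (LINT p|lborel. LINT r|lborel. K r p)"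
    using Fubini_lborel(1)[OF K_meas fin] by (simp add: inner_p)
  also have "\<dots> = of_real (\<rho> ^ n / 2 ^ (n + 1)) * (Gamma z * of_real (\<rho>\<^sup>2 / 4) powr (- z))"
    unfolding inner_r
    by (intro has_bochner_integral_integral_eq has_bochner_integral_mult_right
        has_bochner_integral_inverse_Gamma_complex z) (use \<rho> in auto)
  also have "\<dots> = Gamma z * (of_real (\<rho> ^ n / 2 ^ (n + 1)) * of_real (\<rho>\<^sup>2 / 4) powr (- z))"
    by (simp only: mult_ac)
  \<comment> \<open>As 2z = n + 2 - w, the exponent of \<rho> is n - 2z = w - 2 and that of 2 is 2z
    - n - 1 = 1 - w.\<close>
  also have "of_real (\<rho> ^ n / 2 ^ (n + 1)) * complex_of_real (\<rho>\<^sup>2 / 4) powr (- z) = 2 powr (1 - w) * of_real \<rho> powr (w - 2)"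
  proof -
    have "complex_of_real (\<rho> ^ n / 2 ^ (n + 1)) = exp (of_real (real n * ln \<rho> - real (n + 1) * ln 2))"
      using \<rho> by (simp only: ln_realpow[symmetric] exp_of_real exp_diff) simp
    moreover have "ln (\<rho>\<^sup>2 / 4) = 2 * ln \<rho> - 2 * ln 2"
      using \<rho> ln_realpow[of 2 2] by (simp add: ln_div ln_realpow)
    moreover have "(2 :: complex) powr (1 - w) = exp ((1 - w) * of_real (ln 2))"
      using complex_of_real_powr[of 2] by simp
    moreover have "\<rho>\<^sup>2 / 4 > 0" using \<rho> by simp
    ultimately show ?thesis
      using \<rho> by (simp only: complex_of_real_powr exp_add[symmetric])
        (rule arg_cong[of _ _ exp], simp add: z_def field_simps)
  qed
  finally have "(LINT r|lborel. M r) = 2 powr (1 - w) * of_real \<rho> powr (w - 2) * Gamma z * rGamma a"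
    using Gz by (simp add: Gamma_def field_simps)
  moreover have M_set: "set_integrable lborel {0<..} (\<lambda>r. of_real r powr (1 - w) * of_real (bessel_J n (\<rho> * r)))"
    using M_int' unfolding set_integrable_def M_def .
  ultimately have "((\<lambda>r. of_real r powr (1 - w) * of_real (bessel_J n (\<rho> * r))) has_integral
      2 powr (1 - w) * of_real \<rho> powr (w - 2) * Gamma z * rGamma a) {0<..}"
    using set_borel_integral_eq_integral[OF M_set]
    by (simp add: has_integral_iff set_lebesgue_integral_def M_def)
  moreover have "of_real r powr (- w) * of_real r = complex_of_real r powr (1 - w)" if "r > 0" for r
    using that by (simp add: powr_diff powr_minus field_simps)
  ultimately have "((\<lambda>r. of_real r powr (- w) * of_real r * of_real (bessel_J n (\<rho> * r))) has_integral
      2 powr (1 - w) * of_real \<rho> powr (w - 2) * Gamma z * rGamma a) {0<..}"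
    by (subst has_integral_cong) auto
  then show ?thesis
    unfolding has_hankel_integral_def a_def z_def
    by (subst has_integral_spike_set_eq[of "{0..}" "{0<..}"])
       (auto intro: negligible_subset[of "{0}"])
qed

section \<open>The Riesz potential of a power\<close>

text \<open>Pushing forward along u = |y|^2 gives \<pi> times Euler's integral with exponent
  \<gamma>/2; the bound \<gamma> > -2 is integrability at the origin of the plane.\<close>

lemma has_bochner_integral_gaussian_moment_plane:
  assumes t: "t > 0" and \<gamma>: "\<gamma> > -2"
  shows "has_bochner_integral lborel (\<lambda>y :: complex. exp (- (t * (cmod y)\<^sup>2)) * cmod y powr \<gamma>)
           (pi * (Gamma (\<gamma> / 2 + 1) * t powr (- (\<gamma> / 2 + 1))))"
proof -
  have "(\<integral>\<^sup>+y. ennreal (exp (- (t * (cmod y)\<^sup>2)) * cmod y powr \<gamma>) \<partial>lborel) =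
      (\<integral>\<^sup>+y. ennreal (((cmod y)\<^sup>2) powr (\<gamma> / 2 + 1 - 1) * exp (- (t * (cmod y)\<^sup>2))) \<partial>lborel)"
  proof (rule nn_integral_cong)
    fix y :: complex
    have "(cmod y)\<^sup>2 = cmod y powr 2"
      by (cases "y = 0") (simp_all add: powr_numeral)
    then have "((cmod y)\<^sup>2) powr (\<gamma> / 2 + 1 - 1) = cmod y powr \<gamma>"
      by (simp only: powr_powr) simp
    then show "ennreal (exp (- (t * (cmod y)\<^sup>2)) * cmod y powr \<gamma>) =
        ennreal (((cmod y)\<^sup>2) powr (\<gamma> / 2 + 1 - 1) * exp (- (t * (cmod y)\<^sup>2)))"
      by (simp only: mult.commute)
  qed
  also have "\<dots> = ennreal pi * (\<integral>\<^sup>+u. indicator {0<..} u * ennreal (u powr (\<gamma> / 2 + 1 - 1) * exp (- (t * u))) \<partial>lborel)"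
    by (rule nn_integral_radial) measurable
  also have "(\<integral>\<^sup>+u. indicator {0<..} u * ennreal (u powr (\<gamma> / 2 + 1 - 1) * exp (- (t * u))) \<partial>lborel) =
      (\<integral>\<^sup>+u. ennreal (indicator {0<..} u * (u powr (\<gamma> / 2 + 1 - 1) * exp (- (t * u)))) \<partial>lborel)"
    by (intro nn_integral_cong) (simp add: indicator_def)
  also have "\<dots> = ennreal (Gamma (\<gamma> / 2 + 1) * t powr (- (\<gamma> / 2 + 1)))"
    using assms by (intro nn_integral_Gamma) auto
  finally have "(\<integral>\<^sup>+y. ennreal (exp (- (t * (cmod y)\<^sup>2)) * cmod y powr \<gamma>) \<partial>lborel) =
      ennreal (pi * (Gamma (\<gamma> / 2 + 1) * t powr (- (\<gamma> / 2 + 1))))"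
    by (simp add: ennreal_mult')
  then show ?thesis
    using \<gamma> by (intro has_bochner_integral_nn_integral) (auto intro!: mult_nonneg_nonneg Gamma_real_nonneg)
qed

lemma cmod_diff_square:
  "complex_of_real ((cmod (x - y))\<^sup>2) = of_real ((cmod x)\<^sup>2) + of_real ((cmod y)\<^sup>2) - (x * cnj y + cnj x * y)"
  unfolding complex_norm_square by (simp add: algebra_simps)

text \<open>
  At fixed \<open>t\<close> the factor \<open>e\<^bsup>t (x cnj y + cnj x y)\<^esup>\<close> is expanded into monomials; by rotation invariance
  only the terms \<open>(x cnj y)\<^bsup>n+k\<^esup> (cnj x y)\<^bsup>k\<^esup>\<close> survive the integration against \<open>e\<^bsup>i n \<theta>\<^esup>\<close>.
\<close>

lemma gaussian_convolution_sums:
  fixes x :: complex and \<alpha> t :: real and n :: nat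
  assumes t: "t > 0" and \<alpha>: "\<alpha> > -2"
  defines "a \<equiv> (\<alpha> + real n) / 2 + 1"
  shows "(\<lambda>k. x ^ n * of_real (exp (- (t * (cmod x)\<^sup>2)) * (cmod x) ^ (2 * k) * t ^ (2 * k + n) *
            (pi * (Gamma (a + real k) * t powr (- (a + real k)))) / (fact k * fact (k + n)))) sums
         (LINT y|lborel. of_real (exp (- (t * (cmod (x - y))\<^sup>2)) * cmod y powr \<alpha>) * sgn y ^ n)"
proof -
  define g where "g y = exp (- (t * (cmod x)\<^sup>2)) * (exp (- (t * (cmod y)\<^sup>2)) * cmod y powr \<alpha>)" for y :: complex
  define v where "v y = of_real t * (x * cnj y + cnj x * y)" for y
  define h where "h p y = of_real (g y) * sgn y ^ n * (v y ^ p / fact p)" for p y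
  define G where "G p = pi * (Gamma ((\<alpha> + real p) / 2 + 1) * t powr (- ((\<alpha> + real p) / 2 + 1)))" for p
  \<comment> \<open>\<open>T p\<close> is to be the integral of \<open>h p\<close>, the p-th term of
    the exponential of the mixed exponent \<open>v\<close>. The index j counts the factors x cnj y,
    so the phases are \<open>sgn y\<close> to the power n + p - j and its conjugate to the power j;
    they must balance. As j \<le> p, the truncated subtraction is exact.\<close>
  define T where "T p = of_real (exp (- (t * (cmod x)\<^sup>2)) * t ^ p / fact p) *
     (\<Sum>j\<le>p. of_nat (p choose j) * x ^ j * cnj x ^ (p - j) * (if n + p - j = j then of_real (G p) else 0))" for p
  have meas [measurable]: "g \<in> borel_measurable borel" "v \<in> borel_measurable borel" "h p \<in> borel_measurable borel" for p
    unfolding g_def[abs_def] v_def[abs_def] h_def[abs_def] by measurable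
  have G: "has_bochner_integral lborel (\<lambda>y :: complex. exp (- (t * (cmod y)\<^sup>2)) * cmod y powr \<alpha> * cmod y ^ p) (G p)" for p
  proof -
    have "cmod y powr \<alpha> * cmod y ^ p = cmod y powr (\<alpha> + real p)" for y :: complex
      by (cases "y = 0") (simp_all add: powr_add powr_realpow)
    then show ?thesis
      using has_bochner_integral_gaussian_moment_plane[of t "\<alpha> + real p"] t \<alpha> by (simp add: G_def mult.assoc)
  qed
  have h_int: "has_bochner_integral lborel (h p) (T p)" for p
  proof -
    define c where "c j = of_nat (p choose j) * x ^ j * cnj x ^ (p - j)" for j
    define F where "F u = exp (- (t * u\<^sup>2)) * u powr \<alpha> * u ^ p" for u :: real
    have F [measurable]: "F \<in> borel_measurable borel" unfolding F_def by measurable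
    have F_int: "has_bochner_integral lborel (\<lambda>y :: complex. F (cmod y)) (G p)"
      using G by (simp add: F_def)
    have phase: "has_bochner_integral lborel (\<lambda>y. of_real (F (cmod y)) * (sgn y ^ a * cnj (sgn y) ^ b))
       (if a = b then of_real (G p) else 0)" for a b
    proof -
      have "integrable lborel (\<lambda>y. complex_of_real (F (cmod y)) * (sgn y ^ a * cnj (sgn y) ^ b))"
      proof (rule Bochner_Integration.integrable_bound)
        show "integrable lborel (\<lambda>y :: complex. F (cmod y))"
          using F_int by (simp add: has_bochner_integral_iff)
        show "AE y in lborel. norm (complex_of_real (F (cmod y)) * (sgn y ^ a * cnj (sgn y) ^ b)) \<le> norm (F (cmod y))"
        proof (rule AE_I2)
          fix y :: complex
          have "norm (sgn y) \<le> 1" by (simp add: norm_sgn)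
          then have "norm (sgn y ^ a * cnj (sgn y) ^ b) \<le> 1"
            unfolding norm_mult norm_power complex_mod_cnj by (intro mult_le_one power_le_one) auto
          then show "norm (complex_of_real (F (cmod y)) * (sgn y ^ a * cnj (sgn y) ^ b)) \<le> norm (F (cmod y))"
            by (subst norm_mult) (simp add: mult_left_le)
        qed
      qed measurable
      then show ?thesis
        using integral_radial_phase[OF F, of a b] F_int by (auto simp: has_bochner_integral_iff)
    qed
    have "h p y = of_real (exp (- (t * (cmod x)\<^sup>2)) * t ^ p / fact p) *
       (\<Sum>j\<le>p. c j * (of_real (F (cmod y)) * (sgn y ^ (n + p - j) * cnj (sgn y) ^ j)))" for y
    proof -
      have y: "y = of_real (cmod y) * sgn y"
        by (simp add: sgn_eq)
      have "cnj y = of_real (cmod y) * cnj (sgn y)"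
        by (subst y, simp only: complex_cnj_mult complex_cnj_complex_of_real)
      with y have "x * cnj y + cnj x * y = of_real (cmod y) * (x * cnj (sgn y) + cnj x * sgn y)"
        by (metis (no_types, opaque_lifting) distrib_left mult.left_commute)
      then have "v y ^ p = of_real (t ^ p * cmod y ^ p) * (x * cnj (sgn y) + cnj x * sgn y) ^ p"
        by (simp add: v_def power_mult_distrib)
      also have "(x * cnj (sgn y) + cnj x * sgn y) ^ p =
          (\<Sum>j\<le>p. of_nat (p choose j) * (x * cnj (sgn y)) ^ j * (cnj x * sgn y) ^ (p - j))"
        by (rule binomial_ring)
      also have "\<dots> = (\<Sum>j\<le>p. c j * (sgn y ^ (p - j) * cnj (sgn y) ^ j))"
        by (simp only: c_def power_mult_distrib mult_ac)
      finally have "h p y = of_real (g y) * sgn y ^ n * (of_real (t ^ p * cmod y ^ p) * 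
          (\<Sum>j\<le>p. c j * (sgn y ^ (p - j) * cnj (sgn y) ^ j)) / fact p)"
        by (simp only: h_def)
      also have "\<dots> = of_real (exp (- (t * (cmod x)\<^sup>2)) * t ^ p / fact p) * (of_real (F (cmod y)) * (sgn y ^ n * 
          (\<Sum>j\<le>p. c j * (sgn y ^ (p - j) * cnj (sgn y) ^ j))))"
        by (simp only: g_def F_def of_real_mult of_real_divide of_real_fact) (simp only: divide_inverse mult_ac)
      also have "of_real (F (cmod y)) * (sgn y ^ n * (\<Sum>j\<le>p. c j * (sgn y ^ (p - j) * cnj (sgn y) ^ j))) =
          (\<Sum>j\<le>p. c j * (of_real (F (cmod y)) * (sgn y ^ (n + p - j) * cnj (sgn y) ^ j)))"
        unfolding sum_distrib_left
      proof (rule sum.cong[OF refl])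
        fix j assume "j \<in> {..p}"
        then have "n + p - j = n + (p - j)" by simp
        then show "of_real (F (cmod y)) * (sgn y ^ n * (c j * (sgn y ^ (p - j) * cnj (sgn y) ^ j))) =
            c j * (of_real (F (cmod y)) * (sgn y ^ (n + p - j) * cnj (sgn y) ^ j))"
          by (simp only: power_add mult_ac)
      qed
      finally show ?thesis .
    qed
    then have "h p = (\<lambda>y. of_real (exp (- (t * (cmod x)\<^sup>2)) * t ^ p / fact p) *
       (\<Sum>j\<le>p. c j * (of_real (F (cmod y)) * (sgn y ^ (n + p - j) * cnj (sgn y) ^ j))))" ..
    moreover have "T p = of_real (exp (- (t * (cmod x)\<^sup>2)) * t ^ p / fact p) *
       (\<Sum>j\<le>p. c j * (if n + p - j = j then of_real (G p) else 0))"
      by (simp only: T_def c_def)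
    ultimately show ?thesis
      by (simp only:) (intro has_bochner_integral_mult_right has_bochner_integral_sum phase)
  qed
  have v_norm: "norm (v y) \<le> 2 * t * cmod x * cmod y" for y
  proof -
    have "norm (x * cnj y + cnj x * y) \<le> norm (x * cnj y) + norm (cnj x * y)"
      by (rule norm_triangle_ineq)
    then show ?thesis using t by (simp add: v_def norm_mult mult.assoc)
  qed
  have v_exp: "(\<lambda>p. v y ^ p / fact p) sums exp (v y)" for y
    using exp_converges[of "v y"] by (simp add: scaleR_conv_of_real divide_inverse mult.commute)
  have lim: "of_real (g y) * sgn y ^ n * exp (v y) =
      of_real (exp (- (t * (cmod (x - y))\<^sup>2)) * cmod y powr \<alpha>) * sgn y ^ n" for y
  proof -
    have "of_real (exp (- (t * (cmod (x - y))\<^sup>2))) =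
       exp (of_real (- (t * (cmod x)\<^sup>2))) * exp (of_real (- (t * (cmod y)\<^sup>2))) * exp (v y)"
      unfolding exp_add[symmetric] exp_of_real[symmetric] of_real_minus of_real_mult[of t] cmod_diff_square v_def
      by (rule arg_cong[of _ _ exp]) (simp add: algebra_simps)
    then show ?thesis
      by (simp only: g_def of_real_mult exp_of_real mult_ac)
  qed
  have partial: "(\<lambda>N. LINT y|lborel. (\<Sum>p<N. h p y)) \<longlonglongrightarrow>
     (LINT y|lborel. of_real (exp (- (t * (cmod (x - y))\<^sup>2)) * cmod y powr \<alpha>) * sgn y ^ n)"
  proof (rule integral_dominated_convergence)
    \<comment> \<open>All partial sums are dominated by g(y) exp |v(y)| with |v(y)| \<le> 2t|x||y|.
      Since 2t|x||y| \<le> 2t|x|^2 + (t/2)|y|^2, half of the Gaussian decay in y absorbs the growth,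
      at the price of a constant depending on x.\<close>
    define M where "M = exp (2 * t * (cmod x)\<^sup>2)"
    show "integrable lborel (\<lambda>y :: complex. M * (exp (- (t / 2 * (cmod y)\<^sup>2)) * cmod y powr \<alpha>))"
      using has_bochner_integral_gaussian_moment_plane[of "t / 2" \<alpha>] t \<alpha>
      by (intro integrable_mult_right) (auto simp: has_bochner_integral_iff)
    show "AE y in lborel. (\<lambda>N. \<Sum>p<N. h p y) \<longlonglongrightarrow>
        of_real (exp (- (t * (cmod (x - y))\<^sup>2)) * cmod y powr \<alpha>) * sgn y ^ n"
      using sums_mult[OF v_exp] unfolding lim[symmetric] h_def sums_def by blast
    show "AE y in lborel. norm (\<Sum>p<N. h p y) \<le> M * (exp (- (t / 2 * (cmod y)\<^sup>2)) * cmod y powr \<alpha>)" for N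
    proof (rule AE_I2)
      fix y :: complex
      have "norm (\<Sum>p<N. h p y) \<le> (\<Sum>p<N. norm (h p y))"
        by (rule norm_sum)
      also have "\<dots> \<le> (\<Sum>p<N. g y * (norm (v y) ^ p / fact p))"
        by (intro sum_mono) (auto simp: h_def norm_mult norm_divide norm_power norm_sgn g_def)
      also have "\<dots> = g y * (\<Sum>p<N. norm (v y) ^ p / fact p)"
        by (rule sum_distrib_left[symmetric])
      also have "\<dots> \<le> g y * exp (norm (v y))"
      proof (rule mult_left_mono)
        have "(\<lambda>p. norm (v y) ^ p / fact p) sums exp (norm (v y))"
          using exp_converges[of "norm (v y)"] by (simp add: divide_inverse mult.commute)
        then show "(\<Sum>p<N. norm (v y) ^ p / fact p) \<le> exp (norm (v y))"
          by (metis (no_types, lifting) divide_nonneg_nonneg fact_ge_zero finite_lessThan norm_ge_zero sums_iff sum_le_suminf zero_le_power)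
      qed (simp add: g_def)
      also have "\<dots> \<le> g y * exp (2 * t * cmod x * cmod y)"
        using v_norm by (intro mult_left_mono) (auto simp: g_def)
      also have "\<dots> = exp (- (t * (cmod x)\<^sup>2) - t * (cmod y)\<^sup>2 + 2 * t * cmod x * cmod y) * cmod y powr \<alpha>"
        by (simp add: g_def exp_add exp_diff exp_minus field_simps)
      also have "\<dots> \<le> exp (2 * t * (cmod x)\<^sup>2 - t / 2 * (cmod y)\<^sup>2) * cmod y powr \<alpha>"
      proof -
        have "0 \<le> t * (2 * cmod x - cmod y)\<^sup>2 / 2 + t * (cmod x)\<^sup>2" using t by simp
        then have "- (t * (cmod x)\<^sup>2) - t * (cmod y)\<^sup>2 + 2 * t * cmod x * cmod y \<le> 2 * t * (cmod x)\<^sup>2 - t / 2 * (cmod y)\<^sup>2"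
          by (simp add: power2_eq_square field_simps)
        then show ?thesis by (intro mult_right_mono) auto
      qed
      also have "\<dots> = M * (exp (- (t / 2 * (cmod y)\<^sup>2)) * cmod y powr \<alpha>)"
        unfolding M_def mult.assoc[symmetric] exp_add[symmetric] by simp
      finally show "norm (\<Sum>p<N. h p y) \<le> M * (exp (- (t / 2 * (cmod y)\<^sup>2)) * cmod y powr \<alpha>)" .
    qed
  qed measurable
  have "(LINT y|lborel. (\<Sum>p<N. h p y)) = (\<Sum>p<N. T p)" for N
    by (intro has_bochner_integral_integral_eq has_bochner_integral_sum h_int)
  then have T_sums: "T sums (LINT y|lborel. of_real (exp (- (t * (cmod (x - y))\<^sup>2)) * cmod y powr \<alpha>) * sgn y ^ n)"
    using partial by (simp add: sums_def)
  \<comment> \<open>Balance of the phases means p = 2(j - n) + n, so only the degrees p = 2k + n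
    contribute, each through the single index j = n + k.\<close>
  have T_0: "T p = 0" if "p \<notin> range (\<lambda>k. 2 * k + n)" for p
  proof -
    have "n + p - j \<noteq> j" if "j \<le> p" for j
    proof
      assume "n + p - j = j"
      then have "p = 2 * (j - n) + n" using that by linarith
      then show False using \<open>p \<notin> range (\<lambda>k. 2 * k + n)\<close> by blast
    qed
    then show ?thesis unfolding T_def by (auto intro!: sum.neutral)
  qed
  have T_eq: "T (2 * k + n) = x ^ n * of_real (exp (- (t * (cmod x)\<^sup>2)) * (cmod x) ^ (2 * k) * t ^ (2 * k + n) *
            (pi * (Gamma (a + real k) * t powr (- (a + real k)))) / (fact k * fact (k + n)))" for k
  proof -
    define p where "p = 2 * k + n"
    have "(\<Sum>j\<le>p. of_nat (p choose j) * x ^ j * cnj x ^ (p - j) * (if n + p - j = j then of_real (G p) else 0)) =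
        (\<Sum>j\<in>{k + n}. of_nat (p choose j) * x ^ j * cnj x ^ (p - j) * of_real (G p))"
      by (rule sum.mono_neutral_cong_right) (auto simp: p_def)
    also have "\<dots> = of_nat (p choose (k + n)) * (x ^ n * (x * cnj x) ^ k) * of_real (G p)"
      by (simp add: p_def power_add power_mult_distrib)
    also have "x * cnj x = of_real ((cmod x)\<^sup>2)"
      by (rule complex_norm_square[symmetric])
    also have "(of_nat (p choose (k + n)) :: complex) = of_real (fact p / (fact k * fact (k + n)))"
      using binomial_fact[of "k + n" p, where 'a = complex] by (simp add: p_def mult.commute)
    finally have sum_eq: "(\<Sum>j\<le>p. of_nat (p choose j) * x ^ j * cnj x ^ (p - j) * (if n + p - j = j then of_real (G p) else 0)) =
        of_real (fact p / (fact k * fact (k + n))) * (x ^ n * of_real ((cmod x)\<^sup>2) ^ k) * of_real (G p)" .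
    have Gp: "G p = pi * (Gamma (a + real k) * t powr (- (a + real k)))"
    proof -
      have "(\<alpha> + real p) / 2 + 1 = a + real k" by (simp add: p_def a_def field_simps)
      then show ?thesis by (simp add: G_def)
    qed
    show ?thesis
      unfolding T_def p_def[symmetric] sum_eq unfolding Gp by (simp add: power_mult)
  qed
  have "(\<lambda>k. T (2 * k + n)) sums (LINT y|lborel. of_real (exp (- (t * (cmod (x - y))\<^sup>2)) * cmod y powr \<alpha>) * sgn y ^ n)"
    using T_sums T_0 by (subst sums_mono_reindex) (auto simp: strict_mono_def)
  then show ?thesis unfolding T_eq .
qed

text \<open>At infinity the integrand has size |y|^(-\<beta>-2), which is integrable in the plane
  only for \<beta> > 0. If \<beta> \<le> 0, it dominates a multiple of 1/|y|^2 outside the disc of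
  radius |x|, and in u = |y|^2 this is the divergent integral of 1/u.\<close>

lemma riesz_integrable_imp_pos:
  fixes x :: complex
  assumes s: "0 < s" "s < 1" and x: "x \<noteq> 0"
    and int: "integrable lborel (\<lambda>y. of_real (cmod (x - y) powr (2 * s - 2)) * (of_real (cmod y powr (- \<beta> - 2 * s)) * sgn y ^ n))"
  shows "\<beta> > 0"
proof (rule ccontr)
  assume "\<not> \<beta> > 0"
  then have \<beta>: "\<beta> \<le> 0" by simp
  define r where "r = (cmod x)\<^sup>2"
  have r: "r > 0" using x by (simp add: r_def)
  \<comment> \<open>The first factor comes from |x - y| \<le> 2|y| under a negative exponent, the
    second from |y|^(-\<beta>) \<ge> |x|^(-\<beta>), valid as -\<beta> \<ge> 0.\<close>
  define c where "c = 2 powr (2 * s - 2) * r powr (- \<beta> / 2)"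
  have c: "c > 0" using r by (simp add: c_def)
  define F where "F u = ennreal c * (ennreal (1 / u) * indicator {r<..} u)" for u :: real
  have lower: "F ((cmod y)\<^sup>2) \<le> ennreal (norm (complex_of_real (cmod (x - y) powr (2 * s - 2)) *
       (of_real (cmod y powr (- \<beta> - 2 * s)) * sgn y ^ n)))" for y
  proof (cases "(cmod y)\<^sup>2 > r")
    case True
    then have xy: "cmod y > cmod x" unfolding r_def by (rule power_less_imp_less_base) simp
    then have y: "y \<noteq> 0" "x \<noteq> y" by auto
    have "cmod (x - y) \<le> 2 * cmod y"
      using norm_triangle_ineq4[of x y] xy by simp
    then have 1: "cmod (x - y) powr (2 * s - 2) \<ge> (2 * cmod y) powr (2 * s - 2)"
      using y s by (intro powr_mono2') auto
    have 2: "r powr (- \<beta> / 2) \<le> ((cmod y)\<^sup>2) powr (- \<beta> / 2)"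
      using True r \<beta> by (intro powr_mono2) auto
    have 3: "((cmod y)\<^sup>2) powr (- \<beta> / 2) * (1 / (cmod y)\<^sup>2) = cmod y powr (2 * s - 2) * cmod y powr (- \<beta> - 2 * s)"
    proof -
      have "(cmod y)\<^sup>2 = cmod y powr 2" using y by (simp add: powr_numeral)
      then have "((cmod y)\<^sup>2) powr (- \<beta> / 2) = cmod y powr (- \<beta>)"
        by (simp only: powr_powr) simp
      moreover have "1 / (cmod y)\<^sup>2 = cmod y powr (-2)"
        using y by (simp add: powr_minus_divide powr_numeral)
      ultimately show ?thesis
        by (simp only: powr_add[symmetric]) (simp add: algebra_simps)
    qed
    have "c * (1 / (cmod y)\<^sup>2) \<le> 2 powr (2 * s - 2) * (((cmod y)\<^sup>2) powr (- \<beta> / 2) * (1 / (cmod y)\<^sup>2))"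
      unfolding c_def mult.assoc using 2 by (intro mult_left_mono mult_right_mono) auto
    also have "\<dots> = (2 * cmod y) powr (2 * s - 2) * cmod y powr (- \<beta> - 2 * s)"
      unfolding 3 by (simp add: powr_mult)
    also have "\<dots> \<le> cmod (x - y) powr (2 * s - 2) * cmod y powr (- \<beta> - 2 * s)"
      using 1 by (intro mult_right_mono) auto
    also have "\<dots> = norm (complex_of_real (cmod (x - y) powr (2 * s - 2)) *
       (of_real (cmod y powr (- \<beta> - 2 * s)) * sgn y ^ n))"
      using y by (simp add: norm_mult norm_power norm_sgn)
    finally show ?thesis
      using True c by (simp add: F_def ennreal_mult[symmetric] ennreal_leI)
  qed (simp add: F_def)
  have "(\<integral>\<^sup>+y. F ((cmod y)\<^sup>2) \<partial>lborel) < \<infinity>"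
    using int unfolding integrable_iff_bounded by (auto intro: le_less_trans[OF nn_integral_mono[OF lower]])
  moreover have "(\<integral>\<^sup>+y. F ((cmod y)\<^sup>2) \<partial>lborel) = ennreal pi * (\<integral>\<^sup>+u. indicator {0<..} u * F u \<partial>lborel)"
    by (rule nn_integral_radial) (simp add: F_def[abs_def])
  moreover have "(\<integral>\<^sup>+u. indicator {0<..} u * F u \<partial>lborel) = ennreal c * (\<integral>\<^sup>+u. ennreal (1 / u) * indicator {r<..} u \<partial>lborel)"
    using r unfolding F_def
    by (subst nn_integral_cmult[symmetric]) (auto intro!: nn_integral_cong simp: indicator_def)
  ultimately have fin: "(\<integral>\<^sup>+u. ennreal (1 / u) * indicator {r<..} u \<partial>lborel) < \<infinity>"
    using c by (auto simp: ennreal_mult_less_top ennreal_mult_eq_top_iff top.not_eq_extremum)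
  then obtain M where M: "M \<ge> 0" "(\<integral>\<^sup>+u. ennreal (1 / u) * indicator {r<..} u \<partial>lborel) = ennreal M"
    by (cases "\<integral>\<^sup>+u. ennreal (1 / u) * indicator {r<..} u \<partial>lborel") auto
  \<comment> \<open>Chosen so that the integral of 1/u from r to R is M + 1, beyond the supposed
    total M.\<close>
  define R where "R = r * exp (M + 1)"
  have "r \<le> R" using r M by (simp add: R_def)
  have "ennreal (ln R - ln r) = (\<integral>\<^sup>+u. ennreal (1 / u) * indicator {r..R} u \<partial>lborel)"
    using r \<open>r \<le> R\<close> by (intro nn_integral_FTC_Icc[symmetric]) (auto intro!: derivative_eq_intros)
  also have "\<dots> \<le> (\<integral>\<^sup>+u. ennreal (1 / u) * indicator {r<..} u \<partial>lborel)"
  proof (rule nn_integral_mono_AE)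
    show "AE u in lborel. ennreal (1 / u) * indicator {r..R} u \<le> ennreal (1 / u) * indicator {r<..} u"
      using AE_lborel_singleton[of r] by eventually_elim (auto simp: indicator_def)
  qed
  also have "\<dots> = ennreal M" by (rule M)
  finally have "ln R - ln r \<le> M" using M by simp
  moreover have "ln R = ln r + (M + 1)" using r by (simp add: R_def ln_mult)
  ultimately show False by simp
qed

text \<open>The parameters record two exponents: plane moments of order \<alpha> + 2k + n produce
  \<Gamma>(a + k), and the accumulated power of t is then t^(b+k-1), whose integral against
  exp(-t|x|^2) produces \<Gamma>(b + k).\<close>

lemma riesz_potential_power:
  fixes x :: complex
  assumes s: "0 < s" "s < 1" and \<beta>: "0 < \<beta>" "\<beta> < 2 - 2 * s" and x: "x \<noteq> 0"
    and int: "integrable lborel (\<lambda>y. of_real (cmod (x - y) powr (2 * s - 2)) * (of_real (cmod y powr (- \<beta> - 2 * s)) * sgn y ^ n))"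
  defines "a \<equiv> (real n - \<beta>) / 2 + 1 - s" and "b \<equiv> (real n + \<beta>) / 2"
  shows "of_real (Gamma (1 - s)) * (LINT y|lborel. of_real (cmod (x - y) powr (2 * s - 2)) * (of_real (cmod y powr (- \<beta> - 2 * s)) * sgn y ^ n)) =
     of_real (pi * (Gamma a * Gamma b * Gamma s / (Gamma (b + s) * Gamma (a + s)))) * (of_real (cmod x powr (- \<beta>)) * sgn x ^ n)"
proof -
  define \<alpha> where "\<alpha> = - \<beta> - 2 * s"
  have \<alpha>: "\<alpha> > -2" using \<beta> by (simp add: \<alpha>_def)
  have a: "a > 0" and b: "b > 0" using \<beta> s by (simp_all add: a_def b_def field_simps add_nonneg_pos)
  define f where "f y = complex_of_real (cmod y powr \<alpha>) * sgn y ^ n" for y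
  \<comment> \<open>Subordination needs |x - y| > 0. Setting the kernel to 0 at the single point y =
    x agrees with the convention \<open>0 powr e = 0\<close>, so \<open>inner_t\<close> holds there
    too.\<close>
  define K where "K y t = (if y = x then 0 else indicator {0<..} t *\<^sub>R 
     (of_real (t powr (- s) * exp (- (t * (cmod (x - y))\<^sup>2))) * f y))" for y t
  have [measurable]: "f \<in> borel_measurable borel" unfolding f_def[abs_def] by measurable
  have K_meas: "case_prod K \<in> borel_measurable (lborel \<Otimes>\<^sub>M lborel)"
    unfolding K_def case_prod_unfold by measurable
  have subord: "has_bochner_integral lborel (\<lambda>t. indicator {0<..} t * (t powr (- s) * exp (- (t * (cmod (x - y))\<^sup>2))))
      (Gamma (1 - s) * cmod (x - y) powr (2 * s - 2))" if "y \<noteq> x" for y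
  proof -
    have "(cmod (x - y))\<^sup>2 = cmod (x - y) powr 2" using that by (simp add: powr_numeral)
    then have "((cmod (x - y))\<^sup>2) powr (- (1 - s)) = cmod (x - y) powr (2 * s - 2)"
      by (simp only: powr_powr) simp
    then show ?thesis
      using has_bochner_integral_Gamma_real[of "1 - s" "(cmod (x - y))\<^sup>2"] s that by (simp add: mult.commute)
  qed
  have inner_t: "(LINT t|lborel. K y t) = of_real (Gamma (1 - s)) * (of_real (cmod (x - y) powr (2 * s - 2)) * f y)" for y
  proof (cases "y = x")
    case False
    have "has_bochner_integral lborel (\<lambda>t. complex_of_real (indicator {0<..} t * (t powr (- s) * exp (- (t * (cmod (x - y))\<^sup>2)))) * f y)
        (of_real (Gamma (1 - s) * cmod (x - y) powr (2 * s - 2)) * f y)"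
      by (intro has_bochner_integral_mult_left has_bochner_integral_of_real subord False)
    moreover have "K y t = complex_of_real (indicator {0<..} t * (t powr (- s) * exp (- (t * (cmod (x - y))\<^sup>2)))) * f y" for t
      using False by (simp add: K_def indicator_def)
    ultimately show ?thesis by (simp add: has_bochner_integral_iff mult.assoc)
  qed (simp add: K_def)
  \<comment> \<open>Integrating |K| over t restores the modulus of the Riesz integrand, so Fubini's
    condition is the assumed convergence of the potential.\<close>
  have fin: "(\<integral>\<^sup>+y. (\<integral>\<^sup>+t. ennreal (norm (K y t)) \<partial>lborel) \<partial>lborel) < \<infinity>"
  proof -
    have "(\<integral>\<^sup>+t. ennreal (norm (K y t)) \<partial>lborel) = 
       ennreal (Gamma (1 - s)) * ennreal (norm (of_real (cmod (x - y) powr (2 * s - 2)) * f y))" for y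
    proof (cases "y = x")
      case False
      have "(\<integral>\<^sup>+t. ennreal (norm (K y t)) \<partial>lborel) =
          (\<integral>\<^sup>+t. ennreal (norm (f y)) * ennreal (indicator {0<..} t * (t powr (- s) * exp (- (t * (cmod (x - y))\<^sup>2)))) \<partial>lborel)"
        using False by (intro nn_integral_cong) (simp add: K_def indicator_def norm_mult mult.commute flip: ennreal_mult)
      also have "\<dots> = ennreal (norm (f y)) * (\<integral>\<^sup>+t. ennreal (indicator {0<..} t * (t powr (- s) * exp (- (t * (cmod (x - y))\<^sup>2)))) \<partial>lborel)"
        by (rule nn_integral_cmult) measurable
      also have "(\<integral>\<^sup>+t. ennreal (indicator {0<..} t * (t powr (- s) * exp (- (t * (cmod (x - y))\<^sup>2)))) \<partial>lborel) =
          ennreal (Gamma (1 - s) * cmod (x - y) powr (2 * s - 2))"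
        using subord[OF False] by (subst nn_integral_eq_integral) (auto simp: has_bochner_integral_iff)
      finally show ?thesis
        using s Gamma_real_pos[of "1 - s"] by (simp add: norm_mult mult_ac flip: ennreal_mult)
    qed (simp add: K_def)
    then have "(\<integral>\<^sup>+y. (\<integral>\<^sup>+t. ennreal (norm (K y t)) \<partial>lborel) \<partial>lborel) = 
        ennreal (Gamma (1 - s)) * (\<integral>\<^sup>+y. ennreal (norm (of_real (cmod (x - y) powr (2 * s - 2)) * f y)) \<partial>lborel)"
      by (simp only:) (rule nn_integral_cmult, measurable)
    also have "\<dots> < \<infinity>"
      using int unfolding integrable_iff_bounded f_def \<alpha>_def by (simp add: ennreal_mult_less_top)
    finally show ?thesis .
  qed
  \<comment> \<open>The complex factor x^n is split off so that the series in k is real and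
    nonnegative, a + k being positive; sum and t-integral then commute in
    \<open>ennreal\<close>.\<close>
  define B where "B k t = indicator {0<..} t * (pi * Gamma (a + real k) * cmod x ^ (2 * k) / (fact k * fact (k + n)) *
      (t powr (b + real k - 1) * exp (- (t * (cmod x)\<^sup>2))))" for k t
  have B_nonneg: "B k t \<ge> 0" for k t
    using a by (auto simp: B_def intro!: mult_nonneg_nonneg divide_nonneg_nonneg Gamma_real_nonneg)
  have [measurable]: "B k \<in> borel_measurable borel" for k unfolding B_def[abs_def] by measurable
  have inner_y: "(\<lambda>k. x ^ n * of_real (B k t)) sums (LINT y|lborel. K y t)" for t
  proof (cases "t > 0")
    case True
    have "(LINT y|lborel. K y t) = (LINT y|lborel. of_real (t powr (- s)) * 
       (of_real (exp (- (t * (cmod (x - y))\<^sup>2)) * cmod y powr \<alpha>) * sgn y ^ n))"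
    proof (rule integral_cong_AE)
      show "AE y in lborel. K y t = of_real (t powr (- s)) * 
         (of_real (exp (- (t * (cmod (x - y))\<^sup>2)) * cmod y powr \<alpha>) * sgn y ^ n)"
        using AE_lborel_singleton[of x]
      proof eventually_elim
        case (elim y)
        then show ?case using True by (simp add: K_def f_def)
      qed
      show "(\<lambda>y. K y t) \<in> borel_measurable lborel" unfolding K_def by measurable
    qed measurable
    also have "\<dots> = of_real (t powr (- s)) * 
       (LINT y|lborel. of_real (exp (- (t * (cmod (x - y))\<^sup>2)) * cmod y powr \<alpha>) * sgn y ^ n)"
      by (rule integral_mult_right_zero)
    finally have K: "(LINT y|lborel. K y t) = of_real (t powr (- s)) * 
       (LINT y|lborel. of_real (exp (- (t * (cmod (x - y))\<^sup>2)) * cmod y powr \<alpha>) * sgn y ^ n)" .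
    have a': "(\<alpha> + real n) / 2 + 1 = a" by (simp add: a_def \<alpha>_def field_simps)
    have "x ^ n * of_real (B k t) = of_real (t powr (- s)) * (x ^ n * of_real (exp (- (t * (cmod x)\<^sup>2)) * (cmod x) ^ (2 * k) * t ^ (2 * k + n) *
            (pi * (Gamma (a + real k) * t powr (- (a + real k)))) / (fact k * fact (k + n))))" for k
    proof -
      have "t powr (- s) * t ^ (2 * k + n) * t powr (- (a + real k)) = t powr (b + real k - 1)"
        using True by (simp only: powr_realpow[symmetric] powr_add[symmetric])
          (rule arg_cong[of _ _ "(powr) t"], simp add: a_def b_def field_simps)
      then have "B k t = t powr (- s) * (exp (- (t * (cmod x)\<^sup>2)) * (cmod x) ^ (2 * k) * t ^ (2 * k + n) *
            (pi * (Gamma (a + real k) * t powr (- (a + real k)))) / (fact k * fact (k + n)))"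
        using True by (simp add: B_def divide_inverse mult_ac)
      then show ?thesis by (simp only: of_real_mult mult.left_commute)
    qed
    then show ?thesis
      unfolding K using sums_mult[OF gaussian_convolution_sums[OF True \<alpha>, of x n], of "of_real (t powr (- s))"]
      by (simp only: a')
  next
    case False
    then have "K y t = 0" "B k t = 0" for y k by (simp_all add: B_def K_def)
    then show ?thesis by simp
  qed
  have xn: "x ^ n \<noteq> 0" using x by simp
  define S where "S t = (\<Sum>k. B k t)" for t
  have B_summable: "summable (\<lambda>k. B k t)" for t
  proof -
    have "summable (\<lambda>k. inverse (x ^ n) * (x ^ n * of_real (B k t)))"
      by (rule summable_mult[OF sums_summable[OF inner_y]])
    then have "summable (\<lambda>k. complex_of_real (B k t))"
      by (simp only: mult.assoc[symmetric] left_inverse[OF xn] mult_1)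
    then show ?thesis by (simp only: summable_of_real_iff)
  qed
  have inner_y': "(LINT y|lborel. K y t) = x ^ n * of_real (S t)" for t
    using sums_mult[OF sums_of_real[OF summable_sums[OF B_summable]], of "x ^ n" t] inner_y[of t]
    unfolding S_def by (rule sums_unique2[symmetric])
  define r where "r = (cmod x)\<^sup>2"
  have r: "r > 0" using x by (simp add: r_def)
  define V where "V = pi * r powr (- b) * (Gamma a * Gamma b * Gamma s / (Gamma (b + s) * Gamma (a + s)))"
  have V: "V \<ge> 0" using a b s by (auto simp: V_def intro!: mult_nonneg_nonneg divide_nonneg_nonneg Gamma_real_nonneg)
  have "(\<integral>\<^sup>+t. ennreal (S t) \<partial>lborel) = (\<integral>\<^sup>+t. (\<Sum>k. ennreal (B k t)) \<partial>lborel)"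
    unfolding S_def using B_nonneg B_summable by (intro nn_integral_cong suminf_ennreal2[symmetric]) auto
  also have "\<dots> = (\<Sum>k. \<integral>\<^sup>+t. ennreal (B k t) \<partial>lborel)"
    by (rule nn_integral_suminf) measurable
  also have "\<dots> = (\<Sum>k. ennreal (pi * r powr (- b)) * ennreal (Gamma (a + real k) * Gamma (b + real k) / (fact k * Gamma (real n + 1 + real k))))"
  proof (rule suminf_cong)
    fix k
    define C where "C = pi * Gamma (a + real k) * cmod x ^ (2 * k) / (fact k * fact (k + n))"
    have C: "C \<ge> 0" using a by (auto simp: C_def intro!: mult_nonneg_nonneg divide_nonneg_nonneg Gamma_real_nonneg)
    have "(\<integral>\<^sup>+t. ennreal (B k t) \<partial>lborel) = (\<integral>\<^sup>+t. ennreal C * ennreal (indicator {0<..} t * (t powr (b + real k - 1) * exp (- (r * t)))) \<partial>lborel)"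
    proof (rule nn_integral_cong)
      fix t :: real
      have "B k t = indicator {0<..} t * (C * (t powr (b + real k - 1) * exp (- (t * r))))"
        by (simp only: B_def C_def r_def)
      then show "ennreal (B k t) = ennreal C * ennreal (indicator {0<..} t * (t powr (b + real k - 1) * exp (- (r * t))))"
        using C by (simp add: indicator_def mult.commute flip: ennreal_mult)
    qed
    also have "\<dots> = ennreal C * ennreal (Gamma (b + real k) * r powr (- (b + real k)))"
      using b r by (subst nn_integral_cmult) (auto simp: nn_integral_Gamma)
    also have "\<dots> = ennreal (C * (Gamma (b + real k) * r powr (- (b + real k))))"
      using C by (simp add: ennreal_mult')
    also have "C * (Gamma (b + real k) * r powr (- (b + real k))) = 
       pi * r powr (- b) * (Gamma (a + real k) * Gamma (b + real k) / (fact k * Gamma (real n + 1 + real k)))"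
    proof -
      have "cmod x ^ (2 * k) * r powr (- (b + real k)) = r powr (- b)"
      proof -
        have "cmod x ^ (2 * k) = r powr (real k)" using r by (simp add: r_def power_mult powr_realpow)
        then show ?thesis by (simp add: powr_add[symmetric])
      qed
      moreover have "Gamma (real n + 1 + real k) = fact (k + n)"
        using Gamma_fact[of "k + n", where 'a = real] by (simp add: add_ac)
      ultimately show ?thesis
        by (simp add: C_def divide_inverse mult_ac)
    qed
    also have "ennreal \<dots> = ennreal (pi * r powr (- b)) * ennreal (Gamma (a + real k) * Gamma (b + real k) / (fact k * Gamma (real n + 1 + real k)))"
      by (rule ennreal_mult') simp
    finally show "(\<integral>\<^sup>+t. ennreal (B k t) \<partial>lborel) = \<dots>" .
  qed
  also have "\<dots> = ennreal (pi * r powr (- b)) * (\<Sum>k. ennreal (Gamma (a + real k) * Gamma (b + real k) / (fact k * Gamma (real n + 1 + real k))))"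
    by (rule ennreal_suminf_cmult)
  also have "(\<Sum>k. ennreal (Gamma (a + real k) * Gamma (b + real k) / (fact k * Gamma (real n + 1 + real k)))) =
      ennreal (Gamma a * Gamma b * Gamma s / (Gamma (b + s) * Gamma (a + s)))"
  proof -
    \<comment> \<open>Gauss's third parameter is n + 1, from (k + n)! = \<Gamma>(n + 1 + k). Its
      excess over a + b is s, so convergence of the series is exactly s > 0.\<close>
    have eqs: "real n + 1 - a - b = s" "real n + 1 - a = b + s" "real n + 1 - b = a + s"
      by (simp_all add: a_def b_def field_simps)
    have "a + b < real n + 1" using s by (simp add: a_def b_def field_simps)
    from suminf_Gamma_Gauss[OF a b this] show ?thesis unfolding eqs add_diff_cancel_left' .
  qed
  also have "ennreal (pi * r powr (- b)) * \<dots> = ennreal V"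
    unfolding V_def by (rule ennreal_mult'[symmetric]) simp
  finally have S_nn: "(\<integral>\<^sup>+t. ennreal (S t) \<partial>lborel) = ennreal V" .
  have S_meas [measurable]: "S \<in> borel_measurable borel" unfolding S_def[abs_def] by measurable
  have "has_bochner_integral lborel S V"
    using S_nn V B_nonneg B_summable by (intro has_bochner_integral_nn_integral) (auto simp: S_def intro!: suminf_nonneg)
  then have "has_bochner_integral lborel (\<lambda>t. x ^ n * of_real (S t)) (x ^ n * of_real V)"
    by (intro has_bochner_integral_mult_right has_bochner_integral_of_real)
  then have "(LINT t|lborel. LINT y|lborel. K y t) = x ^ n * of_real V"
    by (simp add: inner_y' has_bochner_integral_iff)
  then have "of_real (Gamma (1 - s)) * (LINT y|lborel. of_real (cmod (x - y) powr (2 * s - 2)) * f y) = x ^ n * of_real V"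
    unfolding Fubini_lborel(1)[OF K_meas fin] inner_t by simp
  also have "x ^ n = of_real (cmod x ^ n) * sgn x ^ n"
    using x by (simp add: sgn_eq power_divide)
  also have "of_real (cmod x ^ n) * sgn x ^ n * of_real V = of_real (cmod x ^ n * V) * sgn x ^ n"
    by simp
  also have "cmod x ^ n * V = pi * (Gamma a * Gamma b * Gamma s / (Gamma (b + s) * Gamma (a + s))) * cmod x powr (- \<beta>)"
  proof -
    have "r = cmod x powr 2" using x by (simp add: r_def powr_numeral)
    moreover have "cmod x ^ n = cmod x powr (real n)" using x by (simp add: powr_realpow)
    ultimately have "cmod x ^ n * r powr (- b) = cmod x powr (real n + 2 * - b)"
      by (simp only: powr_powr powr_add)
    also have "real n + 2 * - b = - \<beta>" by (simp add: b_def field_simps)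
    finally show ?thesis by (simp add: V_def mult_ac)
  qed
  finally show ?thesis
    unfolding f_def \<alpha>_def by (simp only: of_real_mult mult.assoc)
qed

section \<open>Multiplier images of power modes\<close>

text \<open>The closed form is built from entire functions and the reciprocal of an entire one,
  hence meromorphic. Its only possible poles come from \<Gamma>((n + 2 - w)/2), and the hypothesis
  keeps z away from them.\<close>

lemma has_continuation_hankel_powr:
  assumes z: "(of_nat n + 2 - z) / 2 \<notin> \<int>\<^sub>\<le>\<^sub>0" and \<rho>: "\<rho> > 0"
  shows "has_continuation (\<lambda>w. has_hankel_integral n (\<lambda>r. of_real r powr (- w)) \<rho>) z
           (2 powr (1 - z) * of_real \<rho> powr (z - 2) * Gamma ((of_nat n + 2 - z) / 2) * rGamma ((of_nat n + z) / 2))"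
proof -
  define F where "F w = 2 powr (1 - w) * of_real \<rho> powr (w - 2) * Gamma ((of_nat n + 2 - w) / 2) * rGamma ((of_nat n + w) / 2)"
    for w :: complex
  have "(\<lambda>w. 2 powr (1 - w) * of_real \<rho> powr (w - 2)) analytic_on UNIV"
    "(\<lambda>w. rGamma ((of_nat n + 2 - w) / 2)) analytic_on UNIV"
    "(\<lambda>w. rGamma ((of_nat n + w) / 2)) analytic_on UNIV"
    using \<rho> by (auto intro!: analytic_intros)
  then have "(\<lambda>w. 2 powr (1 - w) * of_real \<rho> powr (w - 2) * inverse (rGamma ((of_nat n + 2 - w) / 2)) * rGamma ((of_nat n + w) / 2))
      meromorphic_on UNIV"
    by (intro meromorphic_on_mult[OF meromorphic_on_mult] meromorphic_on_inverse analytic_on_imp_meromorphic_on)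
  then have "F meromorphic_on UNIV"
    by (simp add: F_def[abs_def] Gamma_def)
  moreover have "F analytic_on {z}"
    unfolding F_def[abs_def] using z \<rho> by (auto intro!: analytic_intros)
  moreover have "open ({w. Re w > 3/2} \<inter> {w. Re w < 2})"
    by (intro open_Int open_halfspace_Re_gt open_halfspace_Re_lt)
  \<comment> \<open>The midpoint of the strip witnesses that it is nonempty.\<close>
  moreover have "7/4 \<in> {w. Re w > 3/2} \<inter> {w. Re w < 2}" by simp
  moreover have "has_hankel_integral n (\<lambda>r. of_real r powr (- w)) \<rho> (F w)"
    if "w \<in> {w. Re w > 3/2} \<inter> {w. Re w < 2}" for w
    unfolding F_def using that \<rho> by (intro has_hankel_integral_powr) auto
  ultimately show ?thesis
    unfolding has_continuation_def F_def[symmetric] by blast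
qed

text \<open>The real-exponent form, read off from the continuation clause. The constant c is carried
  along because the second transform of a multiplier image starts from a multiple of a
  power.\<close>

lemma has_hankel_transform_powr:
  assumes z: "(real n - z) / 2 + 1 \<notin> \<int>\<^sub>\<le>\<^sub>0"
    and g: "\<And>r. r > 0 \<Longrightarrow> g r = of_real (c * r powr (- z))"
    and G: "\<And>\<rho>. \<rho> > 0 \<Longrightarrow> G \<rho> = of_real (c * (2 powr (1 - z) * \<rho> powr (z - 2) * Gamma ((real n - z) / 2 + 1) / Gamma ((real n + z) / 2)))"
  shows "has_hankel_transform n g G"
proof (rule has_hankel_transform.continued)
  show "g r = of_real c * of_real r powr (- of_real z)" if "r > 0" for r
    using that by (simp add: g powr_of_real flip: of_real_minus)
  have "(of_nat n + 2 - of_real z) / 2 = complex_of_real ((real n - z) / 2 + 1)"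
    by (simp add: field_simps)
  then show "has_continuation (\<lambda>w. has_hankel_integral n (\<lambda>r. of_real r powr (- w)) \<rho>) (of_real z)
      (2 powr (1 - of_real z) * of_real \<rho> powr (of_real z - 2) * Gamma ((of_nat n + 2 - of_real z) / 2) *
        rGamma ((of_nat n + of_real z) / 2))" if "\<rho> > 0" for \<rho>
    using z that by (intro has_continuation_hankel_powr) (simp_all only: of_real_in_nonpos_Ints_iff not_False_eq_True)
  show "G \<rho> = of_real c * (2 powr (1 - of_real z) * of_real \<rho> powr (of_real z - 2) * Gamma ((of_nat n + 2 - of_real z) / 2) *
        rGamma ((of_nat n + of_real z) / 2))" if "\<rho> > 0" for \<rho>
  proof -
    have 1: "(of_nat n + of_real z) / 2 = complex_of_real ((real n + z) / 2)" by simp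
    have 2: "(of_nat n + 2 - of_real z) / 2 = complex_of_real ((real n - z) / 2 + 1)"
      by (simp add: field_simps)
    have 3: "2 powr (1 - of_real z) = complex_of_real (2 powr (1 - z))"
      using powr_of_real[of 2 "1 - z"] by simp
    have 4: "of_real \<rho> powr (of_real z - 2) = complex_of_real (\<rho> powr (z - 2))"
      using powr_of_real[of \<rho> "z - 2"] that by simp
    show ?thesis
      unfolding G[OF that] 1 2 3 4 rGamma_inverse_Gamma Gamma_complex_of_real
      by (simp only: divide_inverse of_real_mult of_real_inverse)
  qed
qed

text \<open>The first transform gives a multiple of \<rho>^(\<beta>-2); the symbol makes it
  \<rho>^(-z) with z = 2 - \<beta> - 2a, again a power. The hypotheses say in turn that the first
  and the second continuation are regular, and the powers of two combine as 2^(1-\<beta>) 2^(1-z) =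
  2^(2a). The sign of a is left open so that one statement serves the operator and its
  inverse.\<close>

lemma has_multiplier_image_power_mode:
  fixes m :: int
  defines "n \<equiv> nat \<bar>m\<bar>"
  assumes 1: "(real n - \<beta>) / 2 + 1 \<notin> \<int>\<^sub>\<le>\<^sub>0" and 2: "(real n + \<beta>) / 2 + a \<notin> \<int>\<^sub>\<le>\<^sub>0"
    and \<kappa>: "\<kappa> = 2 powr (2 * a) * (Gamma ((real n + \<beta>) / 2 + a) * Gamma ((real n - \<beta>) / 2 + 1)) /
          (Gamma ((real n + \<beta>) / 2) * Gamma ((real n - \<beta>) / 2 + 1 - a))"
  shows "has_multiplier_image a (power_mode m (- \<beta>)) (\<lambda>x. of_real \<kappa> * power_mode m (- \<beta> - 2 * a) x)"
  unfolding has_multiplier_image_def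
proof (intro exI conjI allI impI)
  define C where "C = 2 powr (1 - \<beta>) * Gamma ((real n - \<beta>) / 2 + 1) / Gamma ((real n + \<beta>) / 2)"
  define z where "z = 2 - \<beta> - 2 * a"
  have z1: "(real n - z) / 2 + 1 = (real n + \<beta>) / 2 + a" and z2: "(real n + z) / 2 = (real n - \<beta>) / 2 + 1 - a"
    by (simp_all add: z_def field_simps)
  show "power_mode m (- \<beta>) x = of_real (cmod x powr (- \<beta>)) * cis (of_int m * Arg x)" for x
    by (simp add: power_mode_def)
  show "has_hankel_transform (nat \<bar>m\<bar>) (\<lambda>r. of_real (r powr (- \<beta>))) (\<lambda>\<rho>. of_real (C * \<rho> powr (\<beta> - 2)))"
    unfolding n_def[symmetric] using 1 by (rule has_hankel_transform_powr[where c = 1]) (simp_all add: C_def)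
  show "has_hankel_transform (nat \<bar>m\<bar>) (\<lambda>\<rho>. of_real (\<rho> powr (2 * a)) * of_real (C * \<rho> powr (\<beta> - 2)))
     (\<lambda>r. of_real (\<kappa> * r powr (- \<beta> - 2 * a)))"
    unfolding n_def[symmetric]
  proof (rule has_hankel_transform_powr[where c = C and z = z])
    show "(real n - z) / 2 + 1 \<notin> \<int>\<^sub>\<le>\<^sub>0" using 2 unfolding z1 .
    show "complex_of_real (\<rho> powr (2 * a)) * of_real (C * \<rho> powr (\<beta> - 2)) = of_real (C * \<rho> powr (- z))" for \<rho>
    proof -
      have "\<rho> powr (2 * a) * \<rho> powr (\<beta> - 2) = \<rho> powr (- z)"
        by (simp add: z_def algebra_simps flip: powr_add)
      then show ?thesis by (simp add: mult.left_commute flip: of_real_mult)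
    qed
    have e1: "(2 :: real) powr (2 * a) = 2 powr (1 - \<beta>) * 2 powr (1 - z)"
      by (simp add: z_def flip: powr_add)
    have e2: "z - 2 = - \<beta> - 2 * a" by (simp add: z_def)
    show "complex_of_real (\<kappa> * r powr (- \<beta> - 2 * a)) = of_real (C * (2 powr (1 - z) * r powr (z - 2) *
        Gamma ((real n - z) / 2 + 1) / Gamma ((real n + z) / 2)))" for r
      unfolding z1 z2 e2 \<kappa> C_def e1
      unfolding divide_inverse inverse_mult_distrib
      by (simp only: mult_ac)
  qed
  show "of_real \<kappa> * power_mode m (- \<beta> - 2 * a) x = of_real (\<kappa> * cmod x powr (- \<beta> - 2 * a)) * cis (of_int m * Arg x)" for x
    by (simp add: power_mode_def)
qed

section \<open>From the radial computation to the normalised Riesz potential of a mode\<close>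

lemma power_mode_of_nat: "power_mode (int n) e x = of_real (cmod x powr e) * sgn x ^ n"
proof (cases "x = 0")
  case False
  have "cis (of_int (int n) * Arg x) = cis (Arg x) ^ n"
    by (simp add: Complex.DeMoivre)
  then show ?thesis using False by (simp add: power_mode_def cis_Arg)
qed (simp add: power_mode_def)

lemma power_mode_uminus: "power_mode (- m) e x = cnj (power_mode m e x)"
  by (simp add: power_mode_def cis_cnj)

text \<open>The constant of the kernel is what cancels the by-products of the computation:
  \<Gamma>(1-s) from subordination, \<pi> from the radial measure and \<Gamma>(s) from Gauss's sum.
  With 4^s = 2^(2s) the rest is 1/\<open>mu\<close>.\<close>

lemma riesz_potential_power_mode_of_nat:
  fixes x :: complex
  assumes s: "0 < s" "s < 1" and \<beta>: "\<beta> < 2 - 2 * s" and x: "x \<noteq> 0"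
    and int: "integrable lborel (\<lambda>y. of_real (riesz_kernel s (x - y)) * power_mode (int n) (- \<beta> - 2 * s) y)"
  shows "(LINT y|lborel. of_real (riesz_kernel s (x - y)) * power_mode (int n) (- \<beta> - 2 * s) y) =
           of_real (inverse (mu n s \<beta>)) * power_mode (int n) (- \<beta>) x"
proof -
  define C where "C = Gamma (1 - s) / (4 powr s * pi * Gamma s)"
  define f where "f y = complex_of_real (cmod (x - y) powr (2 * s - 2)) * (of_real (cmod y powr (- \<beta> - 2 * s)) * sgn y ^ n)" for y
  have G: "Gamma s > 0" "Gamma (1 - s) > 0" using s by simp_all
  have C: "C > 0" using G by (simp add: C_def)
  have eq: "of_real (riesz_kernel s (x - y)) * power_mode (int n) (- \<beta> - 2 * s) y = of_real C * f y" for y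
    by (simp add: riesz_kernel_def C_def f_def power_mode_of_nat)
  have "integrable lborel (\<lambda>y. inverse (of_real C) * (of_real C * f y))"
    using int unfolding eq by (rule integrable_mult_right)
  then have f_int: "integrable lborel f"
    using C by (simp add: mult.assoc[symmetric])
  have pos: "\<beta> > 0"
    using riesz_integrable_imp_pos[OF s x f_int[unfolded f_def]] .
  define a where "a = (real n - \<beta>) / 2 + 1 - s"
  define b where "b = (real n + \<beta>) / 2"
  have a: "a > 0" and b: "b > 0" using pos \<beta> s by (simp_all add: a_def b_def field_simps add_nonneg_pos)
  define W where "W = pi * (Gamma a * Gamma b * Gamma s / (Gamma (b + s) * Gamma (a + s)))"
  have "of_real (Gamma (1 - s)) * (LINT y|lborel. f y) = of_real W * power_mode (int n) (- \<beta>) x"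
    unfolding f_def power_mode_of_nat W_def a_def b_def
    by (rule riesz_potential_power[OF s pos \<beta> x f_int[unfolded f_def]])
  then have "(LINT y|lborel. f y) = of_real (W / Gamma (1 - s)) * power_mode (int n) (- \<beta>) x"
    using G by (simp add: field_simps)
  then have "(LINT y|lborel. of_real (riesz_kernel s (x - y)) * power_mode (int n) (- \<beta> - 2 * s) y) =
      of_real (C * (W / Gamma (1 - s))) * power_mode (int n) (- \<beta>) x"
    unfolding eq by simp
  also have "C * (W / Gamma (1 - s)) = inverse (mu n s \<beta>)"
  proof -
    have "(4 :: real) powr s = 2 powr (2 * s)"
      using powr_powr[of 2 2 s] by simp
    moreover have "mu n s \<beta> = 2 powr (2 * s) * (Gamma (b + s) * Gamma (a + s)) / (Gamma b * Gamma a)"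
      by (simp only: mu_def a_def b_def diff_add_cancel)
    moreover have "Gamma a > 0" "Gamma b > 0" "Gamma (b + s) > 0" "Gamma (a + s) > 0"
      using a b s by simp_all
    ultimately show ?thesis
      using G by (simp add: C_def W_def)
  qed
  finally show ?thesis .
qed

text \<open>Negative m follow by complex conjugation: the kernel is real, and \<open>mu\<close>
  depends on |m| only.\<close>

lemma riesz_potential_power_mode:
  fixes x :: complex
  assumes s: "0 < s" "s < 1" and \<beta>: "\<beta> < 2 - 2 * s" and x: "x \<noteq> 0"
    and int: "integrable lborel (\<lambda>y. of_real (riesz_kernel s (x - y)) * power_mode m (- \<beta> - 2 * s) y)"
  shows "(LINT y|lborel. of_real (riesz_kernel s (x - y)) * power_mode m (- \<beta> - 2 * s) y) =
           of_real (inverse (mu (nat \<bar>m\<bar>) s \<beta>)) * power_mode m (- \<beta>) x"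
proof (cases "m \<ge> 0")
  case True
  then show ?thesis
    using riesz_potential_power_mode_of_nat[OF s \<beta> x, of "nat m"] int by simp
next
  case False
  define n where "n = nat (- m)"
  have m: "m = - int n" "nat \<bar>m\<bar> = n" using False by (simp_all add: n_def)
  have eq: "of_real (riesz_kernel s (x - y)) * power_mode m (- \<beta> - 2 * s) y =
      cnj (of_real (riesz_kernel s (x - y)) * power_mode (int n) (- \<beta> - 2 * s) y)" for y
    by (simp add: m(1) power_mode_uminus)
  have "integrable lborel (\<lambda>y. of_real (riesz_kernel s (x - y)) * power_mode (int n) (- \<beta> - 2 * s) y)"
    using integrable_cnj[OF int] by (simp only: eq complex_cnj_cnj)
  note pos = riesz_potential_power_mode_of_nat[OF s \<beta> x this]
  have "(LINT y|lborel. of_real (riesz_kernel s (x - y)) * power_mode m (- \<beta> - 2 * s) y) =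
      cnj (LINT y|lborel. of_real (riesz_kernel s (x - y)) * power_mode (int n) (- \<beta> - 2 * s) y)"
    unfolding eq by (rule Bochner_Integration.integral_cnj)
  also have "\<dots> = of_real (inverse (mu (nat \<bar>m\<bar>) s \<beta>)) * power_mode m (- \<beta>) x"
    unfolding pos m(2) unfolding m(1) power_mode_uminus by simp
  finally show ?thesis .
qed

theorem lemma2p1:
  fixes s \<beta> :: real and m :: int
  assumes "0 < s" and "s < 1"
    and "(of_int \<bar>m\<bar> + \<beta>) / 2 + s \<notin> \<int>\<^sub>\<le>\<^sub>0"
    and "(of_int \<bar>m\<bar> - \<beta>) / 2 + 1 \<notin> \<int>\<^sub>\<le>\<^sub>0"
    and "(of_int \<bar>m\<bar> + \<beta>) / 2 \<notin> \<int>\<^sub>\<le>\<^sub>0"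
    and "(of_int \<bar>m\<bar> - \<beta>) / 2 + 1 - s \<notin> \<int>\<^sub>\<le>\<^sub>0"
  shows "(\<beta> < 2 \<longrightarrow>
            has_frac_laplacian s (power_mode m (-\<beta>))
              (\<lambda>x. of_real (mu (nat \<bar>m\<bar>) s \<beta>) * power_mode m (-\<beta> - 2 * s) x)) \<and>
         (\<beta> < 2 - 2 * s \<longrightarrow>
            has_inverse_frac_laplacian s (power_mode m (-\<beta> - 2 * s))
              (\<lambda>x. of_real (inverse (mu (nat \<bar>m\<bar>) s \<beta>)) * power_mode m (-\<beta>) x))"
proof (intro conjI impI)
  define n where "n = nat \<bar>m\<bar>"
  have n: "(of_int \<bar>m\<bar> :: real) = real n" by (simp add: n_def)
  note nonpos = assms(3-6)[unfolded n]
  show "has_frac_laplacian s (power_mode m (-\<beta>))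
      (\<lambda>x. of_real (mu (nat \<bar>m\<bar>) s \<beta>) * power_mode m (-\<beta> - 2 * s) x)"
    unfolding has_frac_laplacian_def
    by (rule has_multiplier_image_power_mode) (use nonpos in \<open>simp_all add: n_def mu_def\<close>)
  assume \<beta>: "\<beta> < 2 - 2 * s"
  show "has_inverse_frac_laplacian s (power_mode m (-\<beta> - 2 * s))
      (\<lambda>x. of_real (inverse (mu (nat \<bar>m\<bar>) s \<beta>)) * power_mode m (-\<beta>) x)"
    unfolding has_inverse_frac_laplacian_def
  proof (intro conjI allI impI)
    \<comment> \<open>The multiplier lemma is applied with \<beta> + 2s for \<beta> and -s for a.
      This exchanges the numerator and denominator arguments of \<open>mu\<close>, hence gives the
      reciprocal constant, and turns its two regularity conditions into the remaining two
      assumptions.\<close>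
    have eqs: "(real n - (\<beta> + 2 * s)) / 2 + 1 = (real n - \<beta>) / 2 + 1 - s"
      "(real n + (\<beta> + 2 * s)) / 2 = (real n + \<beta>) / 2 + s"
      "(real n + \<beta>) / 2 + s + - s = (real n + \<beta>) / 2"
      "(real n - \<beta>) / 2 + 1 - s - - s = (real n - \<beta>) / 2 + 1"
      by (simp_all add: field_simps)
    have "has_multiplier_image (- s) (power_mode m (- (\<beta> + 2 * s)))
      (\<lambda>x. of_real (inverse (mu (nat \<bar>m\<bar>) s \<beta>)) * power_mode m (- (\<beta> + 2 * s) - 2 * - s) x)"
    proof (rule has_multiplier_image_power_mode)
      show "(real (nat \<bar>m\<bar>) - (\<beta> + 2 * s)) / 2 + 1 \<notin> \<int>\<^sub>\<le>\<^sub>0" 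
        "(real (nat \<bar>m\<bar>) + (\<beta> + 2 * s)) / 2 + - s \<notin> \<int>\<^sub>\<le>\<^sub>0"
        unfolding n_def[symmetric] eqs by (fact nonpos)+
      show "inverse (mu (nat \<bar>m\<bar>) s \<beta>) = 2 powr (2 * - s) *
        (Gamma ((real (nat \<bar>m\<bar>) + (\<beta> + 2 * s)) / 2 + - s) * Gamma ((real (nat \<bar>m\<bar>) - (\<beta> + 2 * s)) / 2 + 1)) /
        (Gamma ((real (nat \<bar>m\<bar>) + (\<beta> + 2 * s)) / 2) * Gamma ((real (nat \<bar>m\<bar>) - (\<beta> + 2 * s)) / 2 + 1 - - s))"
        unfolding n_def[symmetric] eqs mu_def mult_minus_right powr_minus
        unfolding divide_inverse inverse_mult_distrib inverse_inverse_eq by (simp only: mult_ac)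
    qed
    then show "has_multiplier_image (- s) (power_mode m (- \<beta> - 2 * s))
      (\<lambda>x. of_real (inverse (mu (nat \<bar>m\<bar>) s \<beta>)) * power_mode m (-\<beta>) x)"
      by simp
  next
    fix x :: complex
    assume x: "x \<noteq> 0"
      and int: "integrable lborel (\<lambda>y. of_real (riesz_kernel s (x - y)) * power_mode m (- \<beta> - 2 * s) y)"
    show "of_real (inverse (mu (nat \<bar>m\<bar>) s \<beta>)) * power_mode m (-\<beta>) x =
        (LINT y|lborel. of_real (riesz_kernel s (x - y)) * power_mode m (- \<beta> - 2 * s) y)"
      by (rule riesz_potential_power_mode[OF assms(1,2) \<beta> x int, symmetric])
  qed
qed

end
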